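(* Let $\boldsymbol\theta=(\theta_1,\ldots,\theta_{n+1})^{\mathsf T}$, $n\ge2$, be a grid $-\pi=\theta_1<\cdots<\theta_{n+1}=\pi$. The differentiation matrix $D_{(-1)}^{(0),\boldsymbol\theta}$, defined by $\frac{d}{d\theta}\mathbf P^{(-1),\boldsymbol\theta}=\mathbf P^{(0),\boldsymbol\theta}D_{(-1)}^{(0),\boldsymbol\theta}$, is a $CB^3(2,2;1,0)$ matrix. Its non-zero $n\times n$ blocks, with rows labelled by the blocks $\mathbf P_{02},\mathbf P_{11},\mathbf P_{12},\mathbf P_{21},\mathbf P_{22},\ldots$ of $\mathbf P^{(0),\boldsymbol\theta}$ and columns labelled by the blocks $\mathbf H,\mathbf P_{12},\mathbf P_{21},\mathbf P_{22},\mathbf P_{31},\ldots$ of $\mathbf P^{(-1),\boldsymbol\theta}$, are: - column $\mathbf H$: $\|\mathbf p_0^{(0),\boldsymbol\theta}\|^{-2}\,\mathbf P_{02}^{\mathsf T}\mathbf H'$ in row $\mathbf P_{02}$ and $\|\mathbf p_1^{(0),\boldsymbol\theta}\|^{-2}\,\mathbf P_{12}^{\mathsf T}\mathbf H'$ in row $\mathbf P_{12}$; - column $\mathbf P_{m2}$ ($m\ge1$): $D_{m,m+1,\mathbf p}^{(0),\boldsymbol\theta,\mathbf q}$ in row $\mathbf P_{m1}$ and, if $m\ge2$, $D_{m-1,m+1,\mathbf p}^{(0),\boldsymbol\theta,\mathbf q}$ in row $\mathbf P_{m-1,1}$; - column $\mathbf P_{m1}$ ($m\ge2$): $D_{m,m,\mathbf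 q}^{(0),\boldsymbol\theta,\mathbf p}$ in row $\mathbf P_{m-1,2}$ and $D_{m+1,m,\mathbf q}^{(0),\boldsymbol\theta,\mathbf p}$ in row $\mathbf P_{m2}$. Here $D_{j,k,\mathbf p}^{(0),\boldsymbol\theta,\mathbf q}=\operatorname{diag}\big(d_{j,k,\mathbf p}^{(0,h_1),\mathbf q},\ldots,d_{j,k,\mathbf p}^{(0,h_n),\mathbf q}\big)$, and similarly for $D_{j,k,\mathbf q}^{(0),\boldsymbol\theta,\mathbf p}$. The matrix $\mathbf P_{02}^{\mathsf T}\mathbf H'\in\mathbb R^{n\times n}$ has entries $-1$ at $(i,i)$, $1\le i\le n$, entries $1$ at $(i,i+1)$, $1\le i\le n-1$, and at $(n,1)$, and zeros elsewhere; $\mathbf P_{12}^{\mathsf T}\mathbf H'\in\mathbb R^{n\times n}$ has entries $\zeta_i$ at $(i,i)$, $1\le i\le n$, entries $-\zeta_i$ at $(i,i+1)$, $1\le i\le n-1$, $-\zeta_n$ at $(n,1)$, and zeros elsewhere, where $$\zeta_i=h_i\csc(\ell_i)\,\beta^{\tau_i,(-1/2,0,-1/2)}\left[\sin(\varphi_i)\big(2\alpha^{\tau_i,(-1/2,0,-1/2)}-1\big)-\frac{\sin(\varphi_i)-\varphi_i}{1-h_i}\right].$$ Moreover, the weak Laplacian $-\Delta^{(-1),\boldsymbol\theta}:=\big(\frac{d}{d\theta}\mathbf P^{(-1),\boldsymbol\theta}\big)^{\mathsf T}\frac{d}{d\theta}\mathbf P^{(-1),\boldsymbol\theta}$ is a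 $CB^3(2,2;1,0)$ matrix given by $-\Delta^{(-1),\boldsymbol\theta}=[D_{(-1)}^{(0),\boldsymbol\theta}]^{\mathsf T}M^{(0),\boldsymbol\theta}D_{(-1)}^{(0),\boldsymbol\theta}$.
   Context: Semiclassical Jacobi polynomials: for $t>1$, $a,b>-1$, $c\in\mathbb R$, $P_k^{t,(a,b,c)}$ ($k\ge0$, degree exactly $k$) are the orthogonal polynomials on $[0,1]$ with weight $x^a(1-x)^b(t-x)^c$, normalised so that $P_0=1$ and all have the same norm as $1$; write $P_1^{t,(a,b,c)}(x)=\beta^{t,(a,b,c)}(x-\alpha^{t,(a,b,c)})$ with $\beta^{t,(a,b,c)}>0$. For $b=-1$: $P_0^{t,(a,-1,c)}=1$, $P_k^{t,(a,-1,c)}(x)=(1-x)P_{k-1}^{t,(a,1,c)}(x)$, $k\ge1$. Arc polynomials: with $|h|<1$, $\tau=2/(1-h)$, $\sigma=(\cos\theta-1)/(h-1)$: $p_k^{(b,h)}(\theta)=P_k^{\tau,(-1/2,b,-1/2)}(\sigma)$ ($k\ge0$), $q_k^{(b,h)}(\theta)=\sin\theta\,P_{k-1}^{\tau,(1/2,b,1/2)}(\sigma)$ ($k\ge1$). The numbers $d$ are the coefficients in $\frac{d}{d\theta}p_m^{(-1,h)}=d_{m-1,m+1,\mathbf p}^{(0,h),\mathbf q}q_{m-1}^{(0,h)}+d_{m,m+1,\mathbf p}^{(0,h),\mathbf q}q_m^{(0,h)}$ ($m\ge1$, with the $q_0$ term absent) and $\frac{d}{d\theta}q_m^{(-1,h)}=d_{m,m,\mathbf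 q}^{(0,h),\mathbf p}p_{m-1}^{(0,h)}+d_{m+1,m,\mathbf q}^{(0,h),\mathbf p}p_m^{(0,h)}$ ($m\ge1$). Piecewise bases: $E_i=[\theta_i,\theta_{i+1}]$, $\ell_i=\theta_{i+1}-\theta_i$, $\varphi_i=\ell_i/2$, $h_i=\cos\varphi_i$, $\tau_i=2/(1-h_i)$, $a_i(\theta)=\theta-(\theta_i+\theta_{i+1})/2$, index $0$ identified with $n$. $P_{m1;i}^{(b),\boldsymbol\theta}=q_m^{(b,h_i)}\circ a_i$, $P_{m2;i}^{(b),\boldsymbol\theta}=p_m^{(b,h_i)}\circ a_i$ on $E_i$ and $0$ elsewhere; $\mathbf P_{mj}^{(b),\boldsymbol\theta}=[P_{mj;1}^{(b),\boldsymbol\theta}\cdots P_{mj;n}^{(b),\boldsymbol\theta}]$; $\mathbf P^{(0),\boldsymbol\theta}=[\mathbf P_{02}^{(0),\boldsymbol\theta}\ \mathbf P_{11}^{(0),\boldsymbol\theta}\ \mathbf P_{12}^{(0),\boldsymbol\theta}\ \mathbf P_{21}^{(0),\boldsymbol\theta}\cdots]$, $\mathbf P^{(-1),\boldsymbol\theta}=[\mathbf H\ \mathbf P_{12}^{(-1),\boldsymbol\theta}\ \mathbf P_{21}^{(-1),\boldsymbol\theta}\ \mathbf P_{22}^{(-1),\boldsymbol\theta}\ \mathbf P_{31}^{(-1),\boldsymbol\theta}\cdots]$, $\mathbf H=[\phi_1\cdots\phi_n]$, where $\phi_i$ equals $\tfrac12(1+\sin a_{i-1}(\theta)/\sin\varphi_{i-1})$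 on $E_{i-1}$, $\tfrac12(1-\sin a_i(\theta)/\sin\varphi_i)$ on $E_i$, $0$ elsewhere ($E_0=E_n$). Derivatives (also denoted by primes) are piecewise; equalities of functions hold on element interiors. When $n=2$, entries assigned to the same position are not in conflict. When $\ell_i=\pi$, $h_i\csc(\ell_i)$ means its limit $1/(2\sin\varphi_i)$. $[\mathbf P]^{\mathsf T}\mathbf Q$ denotes the matrix of $L^2(-\pi,\pi)$ inner products; in $\mathbf P_{mj}^{\mathsf T}\mathbf H'$ the factor $\mathbf P_{mj}$ means $\mathbf P_{mj}^{(0),\boldsymbol\theta}$. $M^{(0),\boldsymbol\theta}=[\mathbf P^{(0),\boldsymbol\theta}]^{\mathsf T}\mathbf P^{(0),\boldsymbol\theta}$. $\|\mathbf p_m^{(0),\boldsymbol\theta}\|^2=\operatorname{diag}\big(\int_{-\varphi_1}^{\varphi_1}(p_m^{(0,h_1)})^2d\theta,\ldots,\int_{-\varphi_n}^{\varphi_n}(p_m^{(0,h_n)})^2d\theta\big)$ and $\|\cdot\|^{-2}$ is its inverse. Cyclic banded: $A\in\mathbb R^{n\times n}$ is cyclic banded with sub-bandwidths $(\ell,u)$ if $a_{ij}=0$ whenever $i-j>\ell$ or $j-i>u$, except possibly when $n-i+j\le u$ or $n+i-j\le\ell$. $CB^3(\ell,u;\lambda,\mu)$ matrix (with $n\times n$ blocks, finitely or infinitely many): block-banded with block-bandwidths $(\ell,u)$ (block $(I,J)$ vanishes unless $-\ell\le J-I\le u$); top-left block cyclic banded with sub-bandwidths $(\lambda+\mu,\lambda+\mu)$;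 remaining blocks of the first block row cyclic banded with sub-bandwidths $(\lambda,\mu)$; remaining blocks of the first block column cyclic banded with sub-bandwidths $(\mu,\lambda)$; all other blocks diagonal. *)

theory Defs
  imports "HOL-Analysis.Analysis" "HOL-Computational_Algebra.Polynomial"
begin

definition sj_weight :: "real \<Rightarrow> real \<Rightarrow> real \<Rightarrow> real \<Rightarrow> real \<Rightarrow> real" where
  "sj_weight t a b c x = x powr a * (1 - x) powr b * (t - x) powr c"

definition sj_inner :: "real \<Rightarrow> real \<Rightarrow> real \<Rightarrow> real \<Rightarrow> real poly \<Rightarrow> real poly \<Rightarrow> real" where
  "sj_inner t a b c p q = (LBINT x:{0..1}. poly p x * poly q x * sj_weight t a b c x)"

text \<open>Orthogonality and the norm determine the polynomial of degree \<open>k\<close> only up to sign;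
  the sign is fixed by taking the leading coefficient positive.\<close>

definition is_sj :: "real \<Rightarrow> real \<Rightarrow> real \<Rightarrow> real \<Rightarrow> nat \<Rightarrow> real poly \<Rightarrow> bool" where
  "is_sj t a b c k p \<longleftrightarrow>
     degree p = k \<and> lead_coeff p > 0 \<and>
     (\<forall>q. degree q < k \<longrightarrow> sj_inner t a b c p q = 0) \<and>
     sj_inner t a b c p p = sj_inner t a b c 1 1"

definition sj_poly :: "real \<Rightarrow> real \<Rightarrow> real \<Rightarrow> real \<Rightarrow> nat \<Rightarrow> real poly" where
  "sj_poly t a b c k =
     (if b = -1 then (if k = 0 then 1 else [:1, -1:] * (THE p. is_sj t a 1 c (k - 1) p))
      else (THE p. is_sj t a b c k p))"

text \<open>The linear polynomial is \<open>\<beta> (x - \<alpha>)\<close>.\<close>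

definition sj_beta :: "real \<Rightarrow> real \<Rightarrow> real \<Rightarrow> real \<Rightarrow> real" where
  "sj_beta t a b c = coeff (sj_poly t a b c 1) 1"

definition sj_alpha :: "real \<Rightarrow> real \<Rightarrow> real \<Rightarrow> real \<Rightarrow> real" where
  "sj_alpha t a b c = - coeff (sj_poly t a b c 1) 0 / coeff (sj_poly t a b c 1) 1"

definition arc_tau :: "real \<Rightarrow> real" where
  "arc_tau h = 2 / (1 - h)"

definition arc_sigma :: "real \<Rightarrow> real \<Rightarrow> real" where
  "arc_sigma h x = (cos x - 1) / (h - 1)"

definition arc_p :: "real \<Rightarrow> real \<Rightarrow> nat \<Rightarrow> real \<Rightarrow> real" where
  "arc_p b h k x = poly (sj_poly (arc_tau h) (-1/2) b (-1/2) k) (arc_sigma h x)"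

text \<open>There is no \<open>q\<close> of index 0; the value 0 makes the corresponding term of an
  expansion vanish.\<close>

definition arc_q :: "real \<Rightarrow> real \<Rightarrow> nat \<Rightarrow> real \<Rightarrow> real" where
  "arc_q b h k x =
     (if k = 0 then 0 else sin x * poly (sj_poly (arc_tau h) (1/2) b (1/2) (k - 1)) (arc_sigma h x))"

text \<open>The pairs of coefficients in the two-term expansions of the derivatives of \<open>p\<^sub>m\<close> and
  \<open>q\<^sub>m\<close> with parameter \<open>b = -1\<close>.  For \<open>m = 1\<close> the coefficient of the absent \<open>q\<^sub>0\<close> is set to 0.\<close>

definition arc_p_deriv_coeffs :: "real \<Rightarrow> nat \<Rightarrow> real \<times> real" where
  "arc_p_deriv_coeffs h m =
     (THE cd. (m = 1 \<longrightarrow> fst cd = 0) \<and>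
        (\<forall>x\<in>{- arccos h<..<arccos h}.
           (arc_p (-1) h m has_real_derivative
              fst cd * arc_q 0 h (m - 1) x + snd cd * arc_q 0 h m x) (at x)))"

definition arc_q_deriv_coeffs :: "real \<Rightarrow> nat \<Rightarrow> real \<times> real" where
  "arc_q_deriv_coeffs h m =
     (THE cd. \<forall>x\<in>{- arccos h<..<arccos h}.
        (arc_q (-1) h m has_real_derivative
           fst cd * arc_p 0 h (m - 1) x + snd cd * arc_p 0 h m x) (at x))"

text \<open>\<open>arc_d_p h j k\<close> and \<open>arc_d_q h j k\<close> are the numbers with double index \<open>(j, k)\<close>.  In the
  double indices functions are counted by position, starting from 1: \<open>p\<^sub>m\<close> has position \<open>m + 1\<close>
  and \<open>q\<^sub>m\<close> has position \<open>m\<close>.  Thus the derivative of \<open>p\<^sub>m\<close> has coefficients with indices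
  \<open>(m - 1, m + 1)\<close> and \<open>(m, m + 1)\<close>, and that of \<open>q\<^sub>m\<close> has \<open>(m, m)\<close> and \<open>(m + 1, m)\<close>.\<close>

definition arc_d_p :: "real \<Rightarrow> nat \<Rightarrow> nat \<Rightarrow> real" where
  "arc_d_p h j k =
     (if k = j + 2 then fst (arc_p_deriv_coeffs h (k - 1))
      else if k = j + 1 then snd (arc_p_deriv_coeffs h (k - 1))
      else 0)"

definition arc_d_q :: "real \<Rightarrow> nat \<Rightarrow> nat \<Rightarrow> real" where
  "arc_d_q h j k =
     (if j = k then fst (arc_q_deriv_coeffs h k)
      else if j = k + 1 then snd (arc_q_deriv_coeffs h k)
      else 0)"

text \<open>A grid is a function \<open>\<theta>\<close> used at the arguments \<open>1, \<dots>, n + 1\<close>; elements are numbered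
  \<open>1, \<dots>, n\<close>.\<close>

definition elem :: "(nat \<Rightarrow> real) \<Rightarrow> nat \<Rightarrow> real set" where
  "elem \<theta> i = {\<theta> i..\<theta> (i + 1)}"

definition elem_len :: "(nat \<Rightarrow> real) \<Rightarrow> nat \<Rightarrow> real" where
  "elem_len \<theta> i = \<theta> (i + 1) - \<theta> i"

definition elem_phi :: "(nat \<Rightarrow> real) \<Rightarrow> nat \<Rightarrow> real" where
  "elem_phi \<theta> i = elem_len \<theta> i / 2"

definition elem_h :: "(nat \<Rightarrow> real) \<Rightarrow> nat \<Rightarrow> real" where
  "elem_h \<theta> i = cos (elem_phi \<theta> i)"

definition elem_tau :: "(nat \<Rightarrow> real) \<Rightarrow> nat \<Rightarrow> real" where
  "elem_tau \<theta> i = 2 / (1 - elem_h \<theta> i)"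

definition elem_shift :: "(nat \<Rightarrow> real) \<Rightarrow> nat \<Rightarrow> real \<Rightarrow> real" where
  "elem_shift \<theta> i x = x - (\<theta> i + \<theta> (i + 1)) / 2"

definition cyc_pred :: "nat \<Rightarrow> nat \<Rightarrow> nat" where
  "cyc_pred n i = (if i = 1 then n else i - 1)"

text \<open>\<open>pw_arc b \<theta> m j i\<close> is the \<open>q\<^sub>m\<close> (\<open>j = 1\<close>) or \<open>p\<^sub>m\<close> (\<open>j = 2\<close>) of the \<open>i\<close>-th element.\<close>

definition pw_arc :: "real \<Rightarrow> (nat \<Rightarrow> real) \<Rightarrow> nat \<Rightarrow> nat \<Rightarrow> nat \<Rightarrow> real \<Rightarrow> real" where
  "pw_arc b \<theta> m j i x =
     (if x \<in> elem \<theta> i then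
        (if j = 1 then arc_q b (elem_h \<theta> i) m (elem_shift \<theta> i x)
         else arc_p b (elem_h \<theta> i) m (elem_shift \<theta> i x))
      else 0)"

definition hat :: "nat \<Rightarrow> (nat \<Rightarrow> real) \<Rightarrow> nat \<Rightarrow> real \<Rightarrow> real" where
  "hat n \<theta> i x =
     (let i' = cyc_pred n i in
      if x \<in> elem \<theta> i' then (1 + sin (elem_shift \<theta> i' x) / sin (elem_phi \<theta> i')) / 2
      else if x \<in> elem \<theta> i then (1 - sin (elem_shift \<theta> i x) / sin (elem_phi \<theta> i)) / 2
      else 0)"

text \<open>Positions, counted from 0, of the blocks \<open>P\<^sub>m\<^sub>j\<close> in the two bases
  \<open>[P\<^sub>0\<^sub>2 P\<^sub>1\<^sub>1 P\<^sub>1\<^sub>2 P\<^sub>2\<^sub>1 \<dots>]\<close> and \<open>[H P\<^sub>1\<^sub>2 P\<^sub>2\<^sub>1 P\<^sub>2\<^sub>2 P\<^sub>3\<^sub>1 \<dots>]\<close>; \<open>H\<close> has position 0.\<close>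

definition row_pos :: "nat \<Rightarrow> nat \<Rightarrow> nat" where
  "row_pos m j = 2 * m + j - 2"

definition col_pos :: "nat \<Rightarrow> nat \<Rightarrow> nat" where
  "col_pos m j = 2 * m + j - 3"

text \<open>The \<open>i\<close>-th function of the block at position \<open>K\<close>.\<close>

definition basis0 :: "(nat \<Rightarrow> real) \<Rightarrow> nat \<Rightarrow> nat \<Rightarrow> real \<Rightarrow> real" where
  "basis0 \<theta> K i =
     (if even K then pw_arc 0 \<theta> (K div 2) 2 i else pw_arc 0 \<theta> ((K + 1) div 2) 1 i)"

definition basism1 :: "nat \<Rightarrow> (nat \<Rightarrow> real) \<Rightarrow> nat \<Rightarrow> nat \<Rightarrow> real \<Rightarrow> real" where
  "basism1 n \<theta> J i =
     (if J = 0 then hat n \<theta> i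
      else if odd J then pw_arc (-1) \<theta> ((J + 1) div 2) 2 i
      else pw_arc (-1) \<theta> (J div 2 + 1) 1 i)"

lemma basis0_row_pos:
  "basis0 \<theta> (row_pos m 2) i = pw_arc 0 \<theta> m 2 i"
  "m \<ge> 1 \<Longrightarrow> basis0 \<theta> (row_pos m 1) i = pw_arc 0 \<theta> m 1 i"
  by (cases m; simp add: basis0_def row_pos_def)+

lemma basism1_col_pos:
  "m \<ge> 1 \<Longrightarrow> basism1 n \<theta> (col_pos m 2) i = pw_arc (-1) \<theta> m 2 i"
  "m \<ge> 2 \<Longrightarrow> basism1 n \<theta> (col_pos m 1) i = pw_arc (-1) \<theta> m 1 i"
proof -
  show "basism1 n \<theta> (col_pos m 2) i = pw_arc (-1) \<theta> m 2 i" if "m \<ge> 1"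
    using that by (cases m) (auto simp: basism1_def col_pos_def)
  show "basism1 n \<theta> (col_pos m 1) i = pw_arc (-1) \<theta> m 1 i" if "m \<ge> 2"
  proof -
    from that obtain k where "m = Suc (Suc k)" by (metis Suc_le_D numeral_2_eq_2 Suc_le_mono)
    then show ?thesis by (simp add: basism1_def col_pos_def)
  qed
qed

text \<open>The derivative on the element interiors; the value 0 at the remaining points is
  immaterial for integrals.\<close>

definition pw_deriv :: "nat \<Rightarrow> (nat \<Rightarrow> real) \<Rightarrow> (real \<Rightarrow> real) \<Rightarrow> real \<Rightarrow> real" where
  "pw_deriv n \<theta> f x = (if \<exists>i\<in>{1..n}. \<theta> i < x \<and> x < \<theta> (i + 1) then deriv f x else 0)"

definition L2_inner :: "(real \<Rightarrow> real) \<Rightarrow> (real \<Rightarrow> real) \<Rightarrow> real" where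
  "L2_inner f g = (LBINT x:{-pi<..<pi}. f x * g x)"

text \<open>An \<open>n \<times> n\<close> matrix is a function of two indices in \<open>{1..n}\<close>.  A matrix with infinitely many
  \<open>n \<times> n\<close> blocks is a function of two block indices, counted from 0, and two indices in
  \<open>{1..n}\<close>.\<close>

type_synonym matrix = "nat \<Rightarrow> nat \<Rightarrow> real"
type_synonym block_matrix = "nat \<Rightarrow> nat \<Rightarrow> matrix"

definition mat_eq :: "nat \<Rightarrow> matrix \<Rightarrow> matrix \<Rightarrow> bool" where
  "mat_eq n A B \<longleftrightarrow> (\<forall>i\<in>{1..n}. \<forall>j\<in>{1..n}. A i j = B i j)"

definition zero_matrix :: matrix where
  "zero_matrix i j = 0"

definition diag_matrix :: "(nat \<Rightarrow> real) \<Rightarrow> matrix" where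
  "diag_matrix f i j = (if i = j then f i else 0)"

definition mat_mult :: "nat \<Rightarrow> matrix \<Rightarrow> matrix \<Rightarrow> matrix" where
  "mat_mult n A B i j = (\<Sum>k=1..n. A i k * B k j)"

text \<open>The sum over \<open>K\<close> has finitely many non-zero terms if one of the factors has finitely many
  non-zero blocks in each row (\<open>A\<close>) or column (\<open>B\<close>).\<close>

definition block_mult :: "nat \<Rightarrow> block_matrix \<Rightarrow> block_matrix \<Rightarrow> block_matrix" where
  "block_mult n A B I J i j = (\<Sum>\<^sub>\<infinity>K. mat_mult n (A I K) (B K J) i j)"

definition block_transpose :: "block_matrix \<Rightarrow> block_matrix" where
  "block_transpose A I J i j = A J I j i"

definition cyclic_banded :: "nat \<Rightarrow> nat \<Rightarrow> nat \<Rightarrow> matrix \<Rightarrow> bool" where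
  "cyclic_banded n l u A \<longleftrightarrow>
     (\<forall>i\<in>{1..n}. \<forall>j\<in>{1..n}.
        (int i - int j > int l \<or> int j - int i > int u) \<and>
        \<not> (int n - int i + int j \<le> int u \<or> int n + int i - int j \<le> int l) \<longrightarrow> A i j = 0)"

definition CB3 :: "nat \<Rightarrow> nat \<Rightarrow> nat \<Rightarrow> nat \<Rightarrow> nat \<Rightarrow> block_matrix \<Rightarrow> bool" where
  "CB3 n l u lam mu A \<longleftrightarrow>
     (\<forall>I J. \<not> (- int l \<le> int J - int I \<and> int J - int I \<le> int u) \<longrightarrow> mat_eq n (A I J) zero_matrix) \<and>
     cyclic_banded n (lam + mu) (lam + mu) (A 0 0) \<and>
     (\<forall>J\<ge>1. cyclic_banded n lam mu (A 0 J)) \<and>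
     (\<forall>I\<ge>1. cyclic_banded n mu lam (A I 0)) \<and>
     (\<forall>I\<ge>1. \<forall>J\<ge>1. \<forall>i\<in>{1..n}. \<forall>j\<in>{1..n}. i \<noteq> j \<longrightarrow> A I J i j = 0)"

text \<open>The defining equation expresses the derivative of each basis function as a finite linear
  combination, hence the finiteness of the columns.  Entries with indices outside \<open>{1..n}\<close> carry
  no meaning and are fixed to be 0, so that the matrix is determined uniquely.\<close>

definition is_diff_matrix :: "nat \<Rightarrow> (nat \<Rightarrow> real) \<Rightarrow> block_matrix \<Rightarrow> bool" where
  "is_diff_matrix n \<theta> D \<longleftrightarrow>
     (\<forall>K J i j. \<not> (i \<in> {1..n} \<and> j \<in> {1..n}) \<longrightarrow> D K J i j = 0) \<and>
     (\<forall>J. finite {K. \<not> mat_eq n (D K J) zero_matrix}) \<and>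
     (\<forall>J. \<forall>j\<in>{1..n}. \<forall>e\<in>{1..n}. \<forall>x\<in>{\<theta> e<..<\<theta> (e + 1)}.
        (basism1 n \<theta> J j has_real_derivative
           (\<Sum>\<^sub>\<infinity>K. \<Sum>k=1..n. basis0 \<theta> K k x * D K J k j)) (at x))"

definition diff_matrix :: "nat \<Rightarrow> (nat \<Rightarrow> real) \<Rightarrow> block_matrix" where
  "diff_matrix n \<theta> = (THE D. is_diff_matrix n \<theta> D)"

definition mass_matrix :: "(nat \<Rightarrow> real) \<Rightarrow> block_matrix" where
  "mass_matrix \<theta> I J i j = L2_inner (basis0 \<theta> I i) (basis0 \<theta> J j)"

definition weak_laplacian :: "nat \<Rightarrow> (nat \<Rightarrow> real) \<Rightarrow> block_matrix" where
  "weak_laplacian n \<theta> I J i j =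
     L2_inner (pw_deriv n \<theta> (basism1 n \<theta> I i)) (pw_deriv n \<theta> (basism1 n \<theta> J j))"

definition norm_sq_p :: "(nat \<Rightarrow> real) \<Rightarrow> nat \<Rightarrow> nat \<Rightarrow> real" where
  "norm_sq_p \<theta> m i =
     (LBINT x:{- elem_phi \<theta> i..elem_phi \<theta> i}. (arc_p 0 (elem_h \<theta> i) m x)\<^sup>2)"

definition inv_norm_matrix :: "(nat \<Rightarrow> real) \<Rightarrow> nat \<Rightarrow> matrix" where
  "inv_norm_matrix \<theta> m = diag_matrix (\<lambda>i. inverse (norm_sq_p \<theta> m i))"

definition PtH' :: "nat \<Rightarrow> (nat \<Rightarrow> real) \<Rightarrow> nat \<Rightarrow> nat \<Rightarrow> matrix" where
  "PtH' n \<theta> m j i k = L2_inner (pw_arc 0 \<theta> m j i) (pw_deriv n \<theta> (hat n \<theta> k))"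

definition D_p :: "(nat \<Rightarrow> real) \<Rightarrow> nat \<Rightarrow> nat \<Rightarrow> matrix" where
  "D_p \<theta> j k = diag_matrix (\<lambda>i. arc_d_p (elem_h \<theta> i) j k)"

definition D_q :: "(nat \<Rightarrow> real) \<Rightarrow> nat \<Rightarrow> nat \<Rightarrow> matrix" where
  "D_q \<theta> j k = diag_matrix (\<lambda>i. arc_d_q (elem_h \<theta> i) j k)"

text \<open>\<open>h\<^sub>i csc \<ell>\<^sub>i\<close>, extended by its limit.\<close>

definition h_csc :: "(nat \<Rightarrow> real) \<Rightarrow> nat \<Rightarrow> real" where
  "h_csc \<theta> i =
     (if elem_len \<theta> i = pi then 1 / (2 * sin (elem_phi \<theta> i))
      else elem_h \<theta> i * (1 / sin (elem_len \<theta> i)))"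

definition zeta :: "(nat \<Rightarrow> real) \<Rightarrow> nat \<Rightarrow> real" where
  "zeta \<theta> i =
     h_csc \<theta> i * sj_beta (elem_tau \<theta> i) (-1/2) 0 (-1/2) *
     (sin (elem_phi \<theta> i) * (2 * sj_alpha (elem_tau \<theta> i) (-1/2) 0 (-1/2) - 1) -
      (sin (elem_phi \<theta> i) - elem_phi \<theta> i) / (1 - elem_h \<theta> i))"

definition diff_blocks :: "(nat \<times> nat) set" where
  "diff_blocks =
     {(row_pos 0 2, 0), (row_pos 1 2, 0)} \<union>
     {(row_pos m 1, col_pos m 2) | m. m \<ge> 1} \<union>
     {(row_pos (m - 1) 1, col_pos m 2) | m. m \<ge> 2} \<union>
     {(row_pos (m - 1) 2, col_pos m 1) | m. m \<ge> 2} \<union>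
     {(row_pos m 2, col_pos m 1) | m. m \<ge> 2}"

end

theory Submission
  imports Defs
begin

text \<open>
  On an element of half-width \<open>\<phi>\<close> put \<open>h = cos \<phi>\<close>.  The substitution \<open>x = \<sigma>(\<theta>)\<close> turns the singular
  weights of the semiclassical Jacobi polynomials into the smooth forms
  \<open>\<integral> p(\<sigma>) q(\<sigma>) (1 - \<sigma>)\<^sup>b (sin \<theta>)\<^sup>2\<^sup>s d\<theta>\<close> over \<open>[-\<phi>, \<phi>]\<close>.  For \<open>b = 0\<close> this makes the arc
  functions of one element pairwise orthogonal, the parity of \<open>\<theta>\<close> separating \<open>p\<close> from \<open>q\<close>.  For
  \<open>b = -1\<close> the functions vanish at \<open>\<plusminus>\<phi>\<close>, so integrating their derivatives by parts against a
  polynomial of degree \<open>r\<close> moves the problem to the form with \<open>b = 1\<close>, where it vanishes for all but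
  the two highest values of \<open>r\<close>.  A hat function has slope \<open>\<plusminus> cos \<theta> / (2 sin \<phi>)\<close>, which is
  affine in \<open>\<sigma>\<close> and hence a combination of \<open>p\<^sub>0\<close> and \<open>p\<^sub>1\<close>.
\<close>

section \<open>Orthogonal polynomials for an inner product on polynomials\<close>

text \<open>The theorem says which blocks are non-zero, so it is not enough that the low
  coefficients of a derivative vanish: the surviving ones must be shown to differ from 0. The top
  one is, up to a factor involving 1 - h, a quotient of leading coefficients. The lower one is
  detected by pairing with a monomial of the critical degree, which integration by parts turns into
  the pairing of an orthogonal polynomial with a polynomial of exactly its own degree. Polynomials,
  coefficients and matrix are all given by definite descriptions, so existence and uniqueness have
  to be settled before anything can be computed; one abstract locale does this for all the forms at
  once. On the whole grid an entry of the differentiation matrix is \<open>elem_sign\<close> times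
  \<open>dcoef\<close>. Only hats live on two elements, so the cyclic pattern is confined to
  \<open>elem_sign\<close>, while the block pattern is decided by \<open>dcoef\<close>, which sees a
  single element.\<close>

locale poly_inner =
  fixes B :: "real poly \<Rightarrow> real poly \<Rightarrow> real"
  assumes sym: "B p q = B q p"
    and add_left: "B (p + q) r = B p r + B q r"
    and smult_left: "B (smult c p) q = c * B p q"
    and pos: "p \<noteq> 0 \<Longrightarrow> B p p > 0"
begin

lemma add_right: "B r (p + q) = B r p + B r q"
  using add_left sym by metis

lemma smult_right: "B q (smult c p) = c * B q p"
  using smult_left sym by metis

lemma minus_left: "B (p - q) r = B p r - B q r"
  using add_left[of "p - q" q r] by simp

lemma minus_right: "B r (p - q) = B r p - B r q"
  using minus_left sym by metis

lemma zero_left [simp]: "B 0 q = 0"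
  using smult_left[of 0 0 q] by simp

lemma zero_right [simp]: "B q 0 = 0"
  using sym zero_left by metis

text \<open>The conditions of \<open>is_sj\<close> for an abstract form. They are unchanged when the
  form is multiplied by a positive constant.\<close>

definition orth :: "nat \<Rightarrow> real poly \<Rightarrow> bool" where
  "orth k p \<longleftrightarrow> degree p = k \<and> lead_coeff p > 0 \<and>
     (\<forall>q. degree q < k \<longrightarrow> B p q = 0) \<and> B p p = B 1 1"

text \<open>Gram-Schmidt, one direction at a time: x^k made orthogonal to all lower degrees supplies
  the new direction \<open>u\<close>. The lower-degree space is described by vanishing coefficients,
  because \<open>degree q < k\<close> would exclude the zero polynomial for k = 0.\<close>

lemma ex_projection:
  "\<exists>g. (\<forall>i\<ge>k. coeff g i = 0) \<and> (\<forall>q. (\<forall>i\<ge>k. coeff q i = 0) \<longrightarrow> B (f - g) q = 0)"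
proof (induction k arbitrary: f)
  case 0
  have "B (f - 0) q = 0" if "\<forall>i\<ge>0. coeff q i = 0" for q
  proof -
    have "q = 0" using that by (intro poly_eqI) auto
    then show ?thesis by simp
  qed
  then show ?case by (intro exI[of _ 0]) auto
next
  case (Suc k)
  obtain g where g: "\<forall>i\<ge>k. coeff g i = 0" "\<And>q. \<forall>i\<ge>k. coeff q i = 0 \<Longrightarrow> B (f - g) q = 0"
    using Suc.IH[of f] by blast
  obtain v where v: "\<forall>i\<ge>k. coeff v i = 0" "\<And>q. \<forall>i\<ge>k. coeff q i = 0 \<Longrightarrow> B (monom 1 k - v) q = 0"
    using Suc.IH[of "monom 1 k"] by blast
  define u where "u = monom 1 k - v"
  have uk: "coeff u k = 1" and ui: "\<forall>i\<ge>Suc k. coeff u i = 0"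
    using v(1) by (auto simp: u_def)
  have "u \<noteq> 0" using uk by auto
  then have Buu: "B u u > 0" by (rule pos)
  define l where "l = B (f - g) u / B u u"
  define g' where "g' = g + smult l u"
  have "B (f - g') q = 0" if q: "\<forall>i\<ge>Suc k. coeff q i = 0" for q
  proof -
    define q' where "q' = q - smult (coeff q k) u"
    have "\<forall>i\<ge>k. coeff q' i = 0"
    proof (intro allI impI)
      show "coeff q' i = 0" if "i \<ge> k" for i
        using that q ui uk by (cases "i = k") (auto simp: q'_def)
    qed
    then have "B (f - g) q' = 0" "B u q' = 0"
      using g v by (auto simp: u_def)
    moreover have "q = q' + smult (coeff q k) u" by (simp add: q'_def)
    moreover have "B (f - g') r = B (f - g) r - l * B u r" for r
      by (simp add: g'_def minus_left add_left smult_left)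
    ultimately have "B (f - g') q = B (f - g) (q' + smult (coeff q k) u) - l * B u (q' + smult (coeff q k) u)"
      by metis
    also have "\<dots> = coeff q k * (B (f - g) u - l * B u u)"
      using \<open>B (f - g) q' = 0\<close> \<open>B u q' = 0\<close> by (simp add: add_right smult_right algebra_simps)
    finally have "B (f - g') q = coeff q k * (B (f - g) u - l * B u u)" .
    then show ?thesis using Buu by (simp add: l_def)
  qed
  moreover have "\<forall>i\<ge>Suc k. coeff g' i = 0" using g(1) ui by (simp add: g'_def)
  ultimately show ?case by blast
qed

lemma ex_orth: "\<exists>p. orth k p"
proof -
  obtain v where v: "\<forall>i\<ge>k. coeff v i = 0" "\<And>q. \<forall>i\<ge>k. coeff q i = 0 \<Longrightarrow> B (monom 1 k - v) q = 0"
    using ex_projection[of k "monom 1 k"] by blast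
  define u where "u = monom 1 k - v"
  have uk: "coeff u k = 1" and ui: "\<forall>i>k. coeff u i = 0"
    using v(1) by (auto simp: u_def)
  have deg: "degree u = k"
    using uk ui by (intro antisym degree_le le_degree) auto
  have "u \<noteq> 0" using uk by auto
  then have Buu: "B u u > 0" by (rule pos)
  have B1: "B 1 1 > 0" by (rule pos) simp
  define c where "c = sqrt (B 1 1 / B u u)"
  have c: "c > 0" "c * c = B 1 1 / B u u" using Buu B1 by (auto simp: c_def)
  have "orth k (smult c u)"
    unfolding orth_def
  proof (intro conjI allI impI)
    show "B (smult c u) q = 0" if "degree q < k" for q
    proof -
      have "B u q = 0" unfolding u_def using that by (intro v(2)) (auto intro!: coeff_eq_0)
      then show ?thesis by (simp add: smult_left)
    qed
    have "B (smult c u) (smult c u) = (c * c) * B u u"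
      by (simp only: smult_left smult_right mult.assoc)
    also have "\<dots> = B 1 1" unfolding c(2) using Buu by simp
    finally show "B (smult c u) (smult c u) = B 1 1" .
  qed (use c deg uk in auto)
  then show ?thesis by blast
qed

text \<open>Subtracting the multiple of \<open>P\<close> with the same top coefficient leaves a
  remainder of lower degree that is orthogonal to all lower degrees, in particular to
  itself.\<close>

lemma orth_expand1:
  assumes P: "orth k P" and f: "degree f \<le> k" "\<And>q. degree q < k \<Longrightarrow> B f q = 0"
  shows "f = smult (coeff f k / lead_coeff P) P"
proof -
  define g where "g = f - smult (coeff f k / lead_coeff P) P"
  have P': "degree P = k" "lead_coeff P > 0" "\<And>q. degree q < k \<Longrightarrow> B P q = 0"
    using P by (auto simp: orth_def)
  have ck: "coeff g k = 0" using P' by (simp add: g_def)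
  have dg: "degree g \<le> k"
    unfolding g_def using f(1) P'(1) by (intro degree_diff_le) auto
  have "g = 0"
  proof (rule ccontr)
    assume "g \<noteq> 0"
    then have "degree g \<noteq> k" using ck leading_coeff_0_iff by metis
    then have "degree g < k" using dg by simp
    then have "B g g = 0"
      unfolding g_def minus_left[of f] smult_left using f(2) P'(3) by (simp add: g_def)
    then show False using pos[OF \<open>g \<noteq> 0\<close>] by simp
  qed
  then show ?thesis by (simp add: g_def)
qed

text \<open>Two candidates are proportional; equal norms make the factor 1 or -1, and the positive
  leading coefficients exclude -1.\<close>

lemma orth_unique:
  assumes p: "orth k p" and q: "orth k q"
  shows "p = q"
proof -
  define c where "c = coeff p k / lead_coeff q"
  have pq: "p = smult c q"
    unfolding c_def using p by (intro orth_expand1[OF q]) (auto simp: orth_def)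
  have c: "c > 0" using p q by (auto simp: c_def orth_def)
  have "B p p = c * (c * B q q)" by (simp add: pq smult_left smult_right)
  moreover have "B p p = B q q" "B q q > 0"
    using p q pos[of 1] by (auto simp: orth_def)
  ultimately have "c * c = 1" by (simp add: mult.assoc[symmetric])
  then have "c = 1" using c by (metis abs_of_pos real_sqrt_abs2 real_sqrt_one)
  then show ?thesis using pq by simp
qed

lemma ex1_orth: "\<exists>!p. orth k p"
  using ex_orth orth_unique by blast

lemma orth_0: "orth 0 p \<longleftrightarrow> p = 1"
proof -
  have "orth 0 1" by (simp add: orth_def)
  then show ?thesis using orth_unique by blast
qed

text \<open>Source of the two-term derivative expansions. The second clause gives the test for a
  non-zero lower coefficient: if \<open>c\<close> were 0, then \<open>f\<close> would be a multiple
  of \<open>Q\<close> and hence orthogonal to every degree up to k.\<close>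

lemma orth_expand2:
  assumes P: "orth k P" and Q: "orth (Suc k) Q"
    and f: "degree f \<le> Suc k" "\<And>q. degree q < k \<Longrightarrow> B f q = 0"
  obtains c where "f = smult c P + smult (coeff f (Suc k) / lead_coeff Q) Q"
    and "\<And>r. degree r \<le> k \<Longrightarrow> B f r \<noteq> 0 \<Longrightarrow> c \<noteq> 0"
proof -
  define d where "d = coeff f (Suc k) / lead_coeff Q"
  define g where "g = f - smult d Q"
  have Q': "degree Q = Suc k" "lead_coeff Q > 0" "\<And>q. degree q < Suc k \<Longrightarrow> B Q q = 0"
    using Q by (auto simp: orth_def)
  have "coeff g i = 0" if "i > k" for i
  proof (cases "i = Suc k")
    case True
    then show ?thesis using Q' by (simp add: g_def d_def)
  next
    case False
    then show ?thesis using that f(1) Q'(1) by (simp add: g_def coeff_eq_0)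
  qed
  then have "degree g \<le> k" by (intro degree_le) auto
  moreover have "B g q = 0" if "degree q < k" for q
    using that f(2) Q'(3)[of q] by (simp add: g_def minus_left smult_left)
  ultimately have "g = smult (coeff g k / lead_coeff P) P"
    by (rule orth_expand1[OF P])
  then have fe: "f = smult (coeff g k / lead_coeff P) P + smult d Q"
    by (simp add: g_def algebra_simps)
  show thesis
  proof (rule that[OF fe[unfolded d_def]])
    fix r assume r: "degree r \<le> k" "B f r \<noteq> 0"
    show "coeff g k / lead_coeff P \<noteq> 0"
    proof
      assume "coeff g k / lead_coeff P = 0"
      then have "f = smult d Q" using fe by simp
      then show False using r Q'(3)[of r] by (simp add: smult_left)
    qed
  qed
qed

lemma orth_distinct:
  assumes "orth j P" "orth k Q" "j \<noteq> k"
  shows "B P Q = 0"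
  using assms sym[of P Q] by (cases "j < k") (auto simp: orth_def)

text \<open>Up to a scalar, \<open>r\<close> differs from \<open>P\<close> by a polynomial of lower
  degree, which \<open>P\<close> does not see, so the pairing is a non-zero multiple of
  \<open>B P P\<close>.\<close>

lemma orth_top_nonzero:
  assumes P: "orth k P" and r: "degree r \<le> k" "coeff r k \<noteq> 0"
  shows "B P r \<noteq> 0"
proof
  assume z: "B P r = 0"
  have P': "degree P = k" "lead_coeff P > 0" "\<And>q. degree q < k \<Longrightarrow> B P q = 0"
    using P by (auto simp: orth_def)
  define c where "c = coeff P k / coeff r k"
  define g where "g = P - smult c r"
  have gk: "coeff g k = 0" using r by (simp add: g_def c_def)
  have "degree g \<le> k" unfolding g_def using P'(1) r by (intro degree_diff_le) auto
  have "B P g = 0"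
  proof (cases "g = 0")
    case False
    then have "degree g \<noteq> k" using gk leading_coeff_0_iff by metis
    then show ?thesis using \<open>degree g \<le> k\<close> by (intro P'(3)) simp
  qed simp
  then have "B P P = 0" using z by (simp add: g_def minus_right smult_right)
  moreover have "P \<noteq> 0" using P'(2) by auto
  ultimately show False using pos[of P] by simp
qed

end

section \<open>Arc polynomials on one element\<close>

lemma powr_set_integrable_unit:
  fixes a :: real
  assumes "a > -1"
  shows "set_integrable lborel {0..1} (\<lambda>x. x powr a)"
proof -
  have "(\<lambda>x::real. x powr a) integrable_on {0..1}"
    using has_integral_powr_from_0[OF assms, of 1] by (auto simp: integrable_on_def)
  then have "(\<lambda>x::real. x powr a) absolutely_integrable_on {0..1}"
    by (intro nonnegative_absolutely_integrable_1) auto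
  then show ?thesis
    unfolding set_integrable_def by (subst (asm) integrable_completion) auto
qed

text \<open>For t > 1 and b \<ge> 0 only the factor x^a can be unbounded on [0,1]; the others are
  bounded, so a multiple of x^a dominates.\<close>

lemma sj_weight_set_integrable:
  assumes t: "t > 1" and a: "a > -1" and b: "b \<ge> 0"
  shows "set_integrable lborel {0..1} (\<lambda>x. poly p x * poly q x * sj_weight t a b c x)"
proof -
  have "continuous_on {0..1} (\<lambda>x. poly p x * poly q x * (t - x) powr c)"
    using t by (intro continuous_intros) auto
  then have "bounded ((\<lambda>x. poly p x * poly q x * (t - x) powr c) ` {0..1})"
    by (intro compact_imp_bounded compact_continuous_image) auto
  then obtain C where C: "\<forall>x\<in>{0..1}. \<bar>poly p x * poly q x * (t - x) powr c\<bar> \<le> C"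
    by (auto simp: bounded_iff)
  have [measurable]: "poly r \<in> borel_measurable borel" for r :: "real poly"
    by (intro borel_measurable_continuous_onI continuous_intros)
  have I: "set_integrable lborel {0..1} (\<lambda>x. C * x powr a)"
    using powr_set_integrable_unit[OF a] by simp
  show ?thesis
  proof (rule set_integrable_bound[OF I])
    show "set_borel_measurable lborel {0..1} (\<lambda>x. poly p x * poly q x * sj_weight t a b c x)"
      unfolding set_borel_measurable_def sj_weight_def by measurable
    have "norm (poly p x * poly q x * sj_weight t a b c x) \<le> norm (C * x powr a)"
      if x: "x \<in> {0..1}" for x
    proof -
      have b1: "(1 - x) powr b \<le> 1" using x b powr_mono2[of b "1 - x" 1] by simp
      have "norm (poly p x * poly q x * sj_weight t a b c x) =
          (\<bar>poly p x * poly q x * (t - x) powr c\<bar> * (1 - x) powr b) * x powr a"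
        by (simp add: sj_weight_def abs_mult mult_ac)
      also have "\<dots> \<le> (C * 1) * x powr a"
        using bspec[OF C x] b1 by (intro mult_right_mono mult_mono) (auto intro: order_trans[OF abs_ge_zero])
      finally show ?thesis by simp
    qed
    then show "AE x in lborel. x \<in> {0..1} \<longrightarrow>
        norm (poly p x * poly q x * sj_weight t a b c x) \<le> norm (C * x powr a)" by auto
  qed
qed

lemma integral_symmetric_even:
  fixes f :: "real \<Rightarrow> real"
  assumes "continuous_on {-a..a} f" "\<And>x. f (- x) = f x" "a \<ge> 0"
  shows "integral {-a..a} f = 2 * integral {0..a} f"
proof -
  have "integral {-a..0} f + integral {0..a} f = integral {-a..a} f"
    using assms by (intro Henstock_Kurzweil_Integration.integral_combine integrable_continuous_real) auto
  moreover have "integral {-a..0} f = integral {0..a} f"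
    using Henstock_Kurzweil_Integration.integral_reflect_real[of a 0 f] assms by simp
  ultimately show ?thesis by simp
qed

lemma integral_odd_eq_0:
  fixes f :: "real \<Rightarrow> real"
  assumes "\<And>x. f (- x) = - f x"
  shows "integral {-a..a} f = 0"
proof -
  have "integral {-a..a} f = integral {-a..a} (\<lambda>x. f (- x))"
    using Henstock_Kurzweil_Integration.integral_reflect_real[of a "- a" f] by simp
  also have "\<dots> = - integral {-a..a} f"
    using assms by simp
  finally show ?thesis by simp
qed

section \<open>The change of variables on one element\<close>

locale arc =
  fixes \<phi> :: real
  assumes phi_pos: "0 < \<phi>" and phi_less_pi: "\<phi> < pi"
begin

abbreviation h :: real where "h \<equiv> cos \<phi>"
abbreviation \<tau> :: real where "\<tau> \<equiv> arc_tau h"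
abbreviation \<sigma> :: "real \<Rightarrow> real" where "\<sigma> \<equiv> arc_sigma h"

lemma sin_phi_pos: "sin \<phi> > 0"
  using phi_pos phi_less_pi by (rule sin_gt_zero)

lemma h_less_1: "h < 1"
  using cos_monotone_0_pi[of 0 \<phi>] phi_pos phi_less_pi by simp

lemma h_gt_minus_1: "h > -1"
  using cos_monotone_0_pi[of \<phi> pi] phi_pos phi_less_pi by simp

lemma arccos_h: "arccos h = \<phi>"
  using phi_pos phi_less_pi by (intro arccos_cos) auto

lemma tau_gt_1: "\<tau> > 1"
  using h_less_1 h_gt_minus_1 by (simp add: arc_tau_def field_simps)

lemma one_minus_h_tau: "(1 - h) * \<tau> = 2"
  unfolding arc_tau_def using h_less_1
  by (subst times_divide_eq_right, subst nonzero_mult_div_cancel_left) auto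

lemma one_minus_cos: "1 - cos x = (1 - h) * \<sigma> x"
  using h_less_1 by (simp add: arc_sigma_def field_simps)

lemma cos_conv_sigma: "cos x = 1 - (1 - h) * \<sigma> x"
  using one_minus_cos[of x] by simp

text \<open>The origin of \<tau> = 2/(1 - h): the factors 1 - cos and 1 + cos are 1 - h times
  \<sigma> and \<tau> - \<sigma>, the two bases that carry equal exponents in the weight.\<close>

lemma sin_sq_conv_sigma: "(sin x)\<^sup>2 = (1 - h)\<^sup>2 * (\<sigma> x * (\<tau> - \<sigma> x))"
proof -
  have "(sin x)\<^sup>2 = (1 - cos x) * (1 + cos x)"
    by (simp add: sin_squared_eq algebra_simps power2_eq_square)
  also have "1 + cos x = (1 - h) * (\<tau> - \<sigma> x)"
    using one_minus_cos[of x] one_minus_h_tau by (simp add: right_diff_distrib)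
  finally show ?thesis by (simp only: one_minus_cos[of x] power2_eq_square mult_ac)
qed

lemma sigma_0 [simp]: "\<sigma> 0 = 0"
  by (simp add: arc_sigma_def)

lemma sigma_phi [simp]: "\<sigma> \<phi> = 1" "\<sigma> (- \<phi>) = 1"
  using h_less_1 by (simp_all add: arc_sigma_def)

lemma sigma_minus [simp]: "\<sigma> (- x) = \<sigma> x"
  by (simp add: arc_sigma_def)

lemma sigma_pos: "0 < x \<Longrightarrow> x \<le> \<phi> \<Longrightarrow> \<sigma> x > 0"
  using cos_monotone_0_pi[of 0 x] h_less_1 phi_less_pi
  by (simp add: arc_sigma_def field_simps)

lemma sigma_less_1:
  assumes "\<bar>x\<bar> < \<phi>" shows "\<sigma> x < 1"
proof -
  have "h < cos \<bar>x\<bar>" using assms phi_less_pi by (intro cos_monotone_0_pi) auto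
  then show ?thesis using h_less_1 by (simp add: arc_sigma_def field_simps)
qed

lemma sigma_le_1:
  assumes "\<bar>x\<bar> \<le> \<phi>" shows "\<sigma> x \<le> 1"
proof (cases "\<bar>x\<bar> = \<phi>")
  case True
  then have "x = \<phi> \<or> x = - \<phi>" by auto
  then show ?thesis by auto
next
  case False
  then show ?thesis using assms sigma_less_1[of x] by simp
qed

lemma has_real_derivative_sigma:
  "(\<sigma> has_real_derivative sin x / (1 - h)) (at x within S)"
proof -
  have "((\<lambda>x. cos x - 1) has_real_derivative - sin x) (at x within S)"
    by (auto intro!: derivative_eq_intros)
  then have "((\<lambda>x. (cos x - 1) / (h - 1)) has_real_derivative - sin x / (h - 1)) (at x within S)"
    by (rule DERIV_cdivide)
  moreover have "- sin x / (h - 1) = sin x / (1 - h)"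
    using minus_divide_divide[of "sin x" "1 - h"] by simp
  ultimately show ?thesis by (simp add: arc_sigma_def[abs_def])
qed

lemma has_real_derivative_poly_sigma:
  "((\<lambda>x. poly p (\<sigma> x)) has_real_derivative poly (pderiv p) (\<sigma> x) * (sin x / (1 - h))) (at x within S)"
  by (rule DERIV_chain2[OF poly_DERIV has_real_derivative_sigma])

lemma continuous_on_sigma [continuous_intros]: "continuous_on S \<sigma>"
  by (rule DERIV_continuous_on[OF has_real_derivative_sigma])

section \<open>The smooth forms and the weighted inner products\<close>

text \<open>\<open>s = 0\<close> belongs to the p family with exponents -1/2, \<open>s = 1\<close>
  to the q family with exponents 1/2, where each of the two functions contributes a factor sin; both
  exponents read \<open>real s - 1/2\<close>.\<close>

definition form :: "nat \<Rightarrow> nat \<Rightarrow> real poly \<Rightarrow> real poly \<Rightarrow> real" where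
  "form s b p q =
     integral {-\<phi>..\<phi>} (\<lambda>x. poly p (\<sigma> x) * poly q (\<sigma> x) * (1 - \<sigma> x) ^ b * sin x ^ (2 * s))"

lemma form_integrable:
  "(\<lambda>x. poly p (\<sigma> x) * poly q (\<sigma> x) * (1 - \<sigma> x) ^ b * sin x ^ (2 * s)) integrable_on {-\<phi>..\<phi>}"
  by (intro integrable_continuous_real continuous_intros)

sublocale form: poly_inner "form s b" for s b
proof
  fix p q r :: "real poly" and c :: real
  show "form s b p q = form s b q p"
    unfolding form_def by (simp add: mult.commute)
  have "form s b (p + q) r = integral {-\<phi>..\<phi>}
     (\<lambda>x. poly p (\<sigma> x) * poly r (\<sigma> x) * (1 - \<sigma> x) ^ b * sin x ^ (2 * s)
        + poly q (\<sigma> x) * poly r (\<sigma> x) * (1 - \<sigma> x) ^ b * sin x ^ (2 * s))"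
    unfolding form_def by (intro integral_cong) (simp add: algebra_simps)
  also have "\<dots> = form s b p r + form s b q r"
    unfolding form_def by (intro integral_add form_integrable)
  finally show "form s b (p + q) r = form s b p r + form s b q r" .
  have "form s b (smult c p) q = integral {-\<phi>..\<phi>}
     (\<lambda>x. c * (poly p (\<sigma> x) * poly q (\<sigma> x) * (1 - \<sigma> x) ^ b * sin x ^ (2 * s)))"
    unfolding form_def by (intro integral_cong) (simp add: algebra_simps)
  then show "form s b (smult c p) q = c * form s b p q"
    unfolding form_def by simp
next
  fix p :: "real poly" assume p: "p \<noteq> 0"
  let ?f = "\<lambda>x. poly p (\<sigma> x) * poly p (\<sigma> x) * (1 - \<sigma> x) ^ b * sin x ^ (2 * s)"
  have nn: "?f x \<ge> 0" if "x \<in> {-\<phi>..\<phi>}" for x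
  proof -
    have "\<sigma> x \<le> 1" using that by (intro sigma_le_1) auto
    then have "0 \<le> poly p (\<sigma> x) * poly p (\<sigma> x)" "0 \<le> (1 - \<sigma> x) ^ b" "0 \<le> sin x ^ (2 * s)"
      by (auto simp: power_mult)
    then show ?thesis by (metis mult_nonneg_nonneg)
  qed
  have cont: "continuous_on {-\<phi>..\<phi>} ?f"
    by (intro continuous_intros)
  \<comment> \<open>A continuous non-negative integrand with integral 0 vanishes identically, so
    \<open>p\<close> would have all the infinitely many values of \<sigma> on (0,\<phi>) as
    roots.\<close>
  have "form s b p p \<noteq> 0"
  proof
    assume "form s b p p = 0"
    then have z: "?f x = 0" if "x \<in> {-\<phi>..\<phi>}" for x
      using integral_eq_0_iff[OF cont _ nn] phi_pos that unfolding form_def by auto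
    have "poly p (\<sigma> x) = 0" if "x \<in> {0<..<\<phi>}" for x
    proof -
      have "sin x > 0" using that phi_less_pi by (intro sin_gt_zero) auto
      moreover have "\<sigma> x < 1" using that by (intro sigma_less_1) auto
      ultimately show ?thesis using z[of x] that by auto
    qed
    then have sub: "\<sigma> ` {0<..<\<phi>} \<subseteq> {y. poly p y = 0}" by auto
    have "inj_on \<sigma> {0<..<\<phi>}"
    proof (rule inj_onI)
      fix x y assume xy: "x \<in> {0<..<\<phi>}" "y \<in> {0<..<\<phi>}" "\<sigma> x = \<sigma> y"
      then have "cos x = cos y" using cos_conv_sigma[of x] cos_conv_sigma[of y] by simp
      then show "x = y" using xy phi_less_pi cos_inj_pi[of x y] by auto
    qed
    moreover have "finite (\<sigma> ` {0<..<\<phi>})"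
      using sub poly_roots_finite[OF p] by (rule finite_subset)
    ultimately have "finite {0<..<\<phi>}" by (rule finite_imageD[rotated])
    then show False using infinite_Ioo[OF phi_pos] by simp
  qed
  moreover have "form s b p p \<ge> 0"
    unfolding form_def by (rule integral_nonneg[OF form_integrable nn])
  ultimately show "form s b p p > 0" by simp
qed

text \<open>With u = d\<sigma>/d\<theta> one has \<sigma>(\<tau> - \<sigma>) = u^2, so the singular
  powers give u^(2s-1), and the Jacobian u completes this to u^(2s).\<close>

lemma sj_weight_sigma:
  assumes x: "x \<in> {0<..<\<phi>}"
  shows "sj_weight \<tau> (real s - 1/2) (real b) (real s - 1/2) (\<sigma> x) * (sin x / (1 - h)) =
     (1 - \<sigma> x) ^ b * (sin x / (1 - h)) ^ (2 * s)"
proof -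
  define u where "u = sin x / (1 - h)"
  have s: "0 < \<sigma> x" "\<sigma> x < 1" using x sigma_pos[of x] sigma_less_1[of x] by auto
  have u: "u > 0" unfolding u_def using x phi_less_pi h_less_1 by (auto intro!: sin_gt_zero divide_pos_pos)
  have uu: "\<sigma> x * (\<tau> - \<sigma> x) = u powr 2"
    using sin_sq_conv_sigma[of x] h_less_1 u by (simp add: u_def power_divide field_simps)
  have "\<sigma> x powr (real s - 1/2) * (\<tau> - \<sigma> x) powr (real s - 1/2) * u = (u powr 2) powr (real s - 1/2) * u"
    using s tau_gt_1 uu by (simp flip: powr_mult)
  also have "\<dots> = u powr (2 * (real s - 1/2)) * u powr 1"
    using u by (simp only: powr_powr powr_one)
  also have "\<dots> = u powr (real (2 * s))"
    unfolding powr_add[symmetric] by simp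
  also have "\<dots> = u ^ (2 * s)" using u by (rule powr_realpow)
  finally have *: "\<sigma> x powr (real s - 1/2) * (\<tau> - \<sigma> x) powr (real s - 1/2) * u = u ^ (2 * s)" .
  show ?thesis
    unfolding sj_weight_def using s * [folded u_def]
    by (simp add: powr_realpow flip: u_def)
qed

text \<open>The 2 comes from folding [-\<phi>,\<phi>] onto [0,\<phi>], where \<sigma> is monotone;
  the power of 1 - h is the denominator of d\<sigma>/d\<theta>.\<close>

lemma sj_inner_conv_form:
  "sj_inner \<tau> (real s - 1/2) (real b) (real s - 1/2) p q = form s b p q / (2 * (1 - h) ^ (2 * s))"
proof -
  let ?f = "\<lambda>x. poly p x * poly q x * sj_weight \<tau> (real s - 1/2) (real b) (real s - 1/2) x"
  let ?g = "\<lambda>x. poly p (\<sigma> x) * poly q (\<sigma> x) * (1 - \<sigma> x) ^ b * sin x ^ (2 * s)"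
  have "set_integrable lborel {\<sigma> 0..\<sigma> \<phi>} ?f"
    unfolding sigma_0 sigma_phi using tau_gt_1 by (intro sj_weight_set_integrable) auto
  then have "(LBINT x. ?f x * indicator {\<sigma> 0..\<sigma> \<phi>} x) =
      (LBINT x. ?f (\<sigma> x) * (sin x / (1 - h)) * indicator {0..\<phi>} x)"
  proof (rule integral_substitution(2))
    show "(\<sigma> has_real_derivative sin x / (1 - h)) (at x)" for x
      by (rule has_real_derivative_sigma)
    show "continuous_on {0..\<phi>} (\<lambda>x. sin x / (1 - h))"
      using h_less_1 by (intro continuous_intros) auto
    show "sin x / (1 - h) \<ge> 0" if "x \<in> {0..\<phi>}" for x
      using that phi_less_pi h_less_1 by (auto intro!: divide_nonneg_pos sin_ge_zero)
  qed (use phi_pos in auto)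
  also have "\<dots> = (LBINT x. (?g x / (1 - h) ^ (2 * s)) * indicator {0..\<phi>} x)"
  \<comment> \<open>The identity for the weight holds in the open interval; the two endpoints are
    negligible.\<close>
  proof (rule integral_discrete_difference[where X="{0, \<phi>}"])
    fix x assume x: "x \<notin> {0, \<phi>}"
    show "?f (\<sigma> x) * (sin x / (1 - h)) * indicator {0..\<phi>} x = (?g x / (1 - h) ^ (2 * s)) * indicator {0..\<phi>} x"
    proof (cases "x \<in> {0<..<\<phi>}")
      case True
      then have "?f (\<sigma> x) * (sin x / (1 - h)) = ?g x / (1 - h) ^ (2 * s)"
        by (simp only: mult.assoc sj_weight_sigma) (simp add: power_divide)
      then show ?thesis by simp
    qed (use x in \<open>auto simp: indicator_def\<close>)
  qed auto
  also have "\<dots> = (LBINT x:{0..\<phi>}. ?g x / (1 - h) ^ (2 * s))"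
    by (simp add: set_lebesgue_integral_def mult_ac)
  also have "\<dots> = integral {0..\<phi>} (\<lambda>x. ?g x / (1 - h) ^ (2 * s))"
    using h_less_1
    by (intro set_borel_integral_eq_integral(2) borel_integrable_atLeastAtMost' continuous_intros) auto
  also have "\<dots> = integral {0..\<phi>} ?g / (1 - h) ^ (2 * s)"
    by simp
  also have "integral {0..\<phi>} ?g = form s b p q / 2"
    unfolding form_def using phi_pos
    by (subst integral_symmetric_even) (auto intro!: continuous_intros simp: power_mult)
  finally show ?thesis
    by (simp add: sj_inner_def set_lebesgue_integral_def mult_ac)
qed

lemma is_sj_conv_orth:
  "is_sj \<tau> (real s - 1/2) (real b) (real s - 1/2) k = form.orth s b k"
  by (intro ext, unfold is_sj_def form.orth_def sj_inner_conv_form) (use h_less_1 in auto)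

definition arc_poly :: "nat \<Rightarrow> nat \<Rightarrow> nat \<Rightarrow> real poly" where
  "arc_poly s b k = sj_poly \<tau> (real s - 1/2) (real b) (real s - 1/2) k"

text \<open>Here \<open>b\<close> is a natural number, so the branch of \<open>sj_poly\<close> for b
  = -1 is never taken.\<close>

lemma orth_arc_poly: "form.orth s b k (arc_poly s b k)"
  using theI'[OF form.ex1_orth] by (simp add: arc_poly_def sj_poly_def is_sj_conv_orth)

lemma degree_arc_poly [simp]: "degree (arc_poly s b k) = k"
  using orth_arc_poly by (auto simp: form.orth_def)

lemma arc_poly_0 [simp]: "arc_poly s b 0 = 1"
  using orth_arc_poly form.orth_0 by blast

lemma lead_arc_poly_pos: "coeff (arc_poly s b k) k > 0"
  using orth_arc_poly[of s b k] by (auto simp: form.orth_def)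

lemma arc_poly_nonzero [simp]: "arc_poly s b k \<noteq> 0"
  using lead_arc_poly_pos[of s b k] by auto

lemma arc_p_0: "arc_p 0 h k x = poly (arc_poly 0 0 k) (\<sigma> x)"
  by (simp add: arc_p_def arc_poly_def)

lemma arc_q_0: "arc_q 0 h k x = (if k = 0 then 0 else sin x * poly (arc_poly 1 0 (k - 1)) (\<sigma> x))"
  by (simp add: arc_q_def arc_poly_def)

lemma arc_p_m1:
  "k \<ge> 1 \<Longrightarrow> arc_p (-1) h k x = poly ([:1, -1:] * arc_poly 0 1 (k - 1)) (\<sigma> x)"
  by (simp add: arc_p_def arc_poly_def sj_poly_def)

lemma arc_q_m1:
  "k \<ge> 2 \<Longrightarrow> arc_q (-1) h k x = sin x * poly ([:1, -1:] * arc_poly 1 1 (k - 2)) (\<sigma> x)"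
  by (simp add: arc_q_def arc_poly_def sj_poly_def numeral_2_eq_2 diff_Suc split: nat.splits)

section \<open>The orthogonal basis of one element\<close>

text \<open>A single sequence in the order of the row blocks, so that the index is at the same time
  the block position used by \<open>basis0\<close>.\<close>

definition arc_fun :: "nat \<Rightarrow> real \<Rightarrow> real" where
  "arc_fun K x = (if even K then arc_p 0 h (K div 2) x else arc_q 0 h ((K + 1) div 2) x)"

lemma arc_fun_altdef: "arc_fun K x = sin x ^ (K mod 2) * poly (arc_poly (K mod 2) 0 (K div 2)) (\<sigma> x)"
proof (cases "even K")
  case True
  then have "K mod 2 = 0" by auto
  then show ?thesis using True by (simp add: arc_fun_def arc_p_0)
next
  case False
  then have "K mod 2 = 1" "(K + 1) div 2 = Suc (K div 2)" by (auto simp: odd_iff_mod_2_eq_one)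
  then show ?thesis using False by (simp add: arc_fun_def arc_q_0)
qed

lemma continuous_on_arc_fun [continuous_intros]: "continuous_on S (arc_fun K)"
  unfolding arc_fun_altdef[abs_def] by (intro continuous_intros)

definition arc_sqnorm :: "nat \<Rightarrow> real" where
  "arc_sqnorm K = integral {-\<phi>..\<phi>} (\<lambda>x. arc_fun K x * arc_fun K x)"

lemma integral_arc_fun_arc_fun_same_parity:
  assumes "K mod 2 = s" "L mod 2 = s"
  shows "integral {-\<phi>..\<phi>} (\<lambda>x. arc_fun K x * arc_fun L x) = form s 0 (arc_poly s 0 (K div 2)) (arc_poly s 0 (L div 2))"
  unfolding form_def
  by (intro integral_cong) (simp add: arc_fun_altdef assms power_add mult_2 mult_2_right mult_ac)

lemma integral_arc_fun_arc_fun: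
  assumes "K \<noteq> L"
  shows "integral {-\<phi>..\<phi>} (\<lambda>x. arc_fun K x * arc_fun L x) = 0"
proof (cases "K mod 2 = L mod 2")
  case True
  then have "K div 2 \<noteq> L div 2" using assms by (metis div_mult_mod_eq)
  then show ?thesis
    using form.orth_distinct[OF orth_arc_poly orth_arc_poly]
    by (simp add: integral_arc_fun_arc_fun_same_parity[OF True refl])
next
  case False
  then have "(K mod 2 = 0 \<and> L mod 2 = 1) \<or> (K mod 2 = 1 \<and> L mod 2 = 0)" by presburger
  then show ?thesis by (intro integral_odd_eq_0) (auto simp: arc_fun_altdef)
qed

lemma arc_sqnorm_pos: "arc_sqnorm K > 0"
  unfolding arc_sqnorm_def by (subst integral_arc_fun_arc_fun_same_parity[OF refl refl]) (rule form.pos[OF arc_poly_nonzero])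

lemma integral_sum_arc_fun:
  assumes "finite S"
  shows "integral {-\<phi>..\<phi>} (\<lambda>x. (\<Sum>K\<in>S. c K * arc_fun K x) * arc_fun L x) = (if L \<in> S then c L * arc_sqnorm L else 0)"
proof -
  have "integral {-\<phi>..\<phi>} (\<lambda>x. (\<Sum>K\<in>S. c K * arc_fun K x) * arc_fun L x) =
      integral {-\<phi>..\<phi>} (\<lambda>x. \<Sum>K\<in>S. c K * (arc_fun K x * arc_fun L x))"
    by (simp add: sum_distrib_right mult.assoc)
  also have "\<dots> = (\<Sum>K\<in>S. integral {-\<phi>..\<phi>} (\<lambda>x. c K * (arc_fun K x * arc_fun L x)))"
    by (intro integral_sum assms integrable_continuous_real continuous_intros)
  also have "\<dots> = (\<Sum>K\<in>S. if K = L then c L * arc_sqnorm L else 0)"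
    by (intro sum.cong refl) (auto simp: integral_arc_fun_arc_fun arc_sqnorm_def)
  also have "\<dots> = (if L \<in> S then c L * arc_sqnorm L else 0)"
    using assms by (simp add: sum.delta)
  finally show ?thesis .
qed

lemma integral_sum_arc_fun_sum:
  assumes "finite S" "finite S'"
  shows "integral {-\<phi>..\<phi>} (\<lambda>x. (\<Sum>K\<in>S. c K * arc_fun K x) * (\<Sum>L\<in>S'. d L * arc_fun L x)) =
     (\<Sum>K\<in>S \<inter> S'. c K * d K * arc_sqnorm K)"
proof -
  have "integral {-\<phi>..\<phi>} (\<lambda>x. (\<Sum>K\<in>S. c K * arc_fun K x) * (\<Sum>L\<in>S'. d L * arc_fun L x)) =
      integral {-\<phi>..\<phi>} (\<lambda>x. \<Sum>L\<in>S'. d L * ((\<Sum>K\<in>S. c K * arc_fun K x) * arc_fun L x))"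
    by (simp add: sum_distrib_left mult_ac)
  also have "\<dots> = (\<Sum>L\<in>S'. integral {-\<phi>..\<phi>} (\<lambda>x. d L * ((\<Sum>K\<in>S. c K * arc_fun K x) * arc_fun L x)))"
    by (intro integral_sum assms integrable_continuous_real continuous_intros)
  also have "\<dots> = (\<Sum>L\<in>S'. if L \<in> S then c L * d L * arc_sqnorm L else 0)"
    by (intro sum.cong refl) (auto simp: integral_sum_arc_fun[OF assms(1)])
  also have "\<dots> = (\<Sum>K\<in>S \<inter> S'. c K * d K * arc_sqnorm K)"
    using assms by (simp add: sum.inter_restrict[symmetric] Int_commute)
  finally show ?thesis .
qed

text \<open>Integrating against \<open>arc_fun L\<close> isolates its coefficient. The open interval
  is what comparing derivatives on element interiors provides.\<close>

lemma arc_fun_independent: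
  assumes "finite S" "\<And>x. x \<in> {-\<phi><..<\<phi>} \<Longrightarrow> (\<Sum>K\<in>S. c K * arc_fun K x) = 0" "L \<in> S"
  shows "c L = 0"
proof -
  have "integral {-\<phi>..\<phi>} (\<lambda>x. 0) = integral {-\<phi>..\<phi>} (\<lambda>x. (\<Sum>K\<in>S. c K * arc_fun K x) * arc_fun L x)"
    by (rule integral_spike[where S="{-\<phi>, \<phi>}"]) (use assms(2) in auto)
  then show ?thesis using integral_sum_arc_fun[OF assms(1), of c L] assms(3) arc_sqnorm_pos[of L] by simp
qed

section \<open>Derivatives of the functions with parameter -1\<close>

text \<open>The derivative of sin \<theta> p(\<sigma>), divided by 1 - h and written as a polynomial
  in \<sigma>, using cos \<theta> = (1 - h)(\<tau>/2 - \<sigma>) and the formula for the square of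
  the sine.\<close>

definition deriv_sin_poly :: "real poly \<Rightarrow> real poly" where
  "deriv_sin_poly p = [:\<tau> / 2, -1:] * p + [:0, \<tau>, -1:] * pderiv p"

lemma has_real_derivative_sin_poly_sigma:
  "((\<lambda>x. sin x * poly p (\<sigma> x)) has_real_derivative (1 - h) * poly (deriv_sin_poly p) (\<sigma> x)) (at x within S)"
proof -
  have "((\<lambda>x. sin x * poly p (\<sigma> x)) has_real_derivative
      cos x * poly p (\<sigma> x) + poly (pderiv p) (\<sigma> x) * (sin x / (1 - h)) * sin x) (at x within S)"
    by (intro DERIV_mult DERIV_sin[THEN DERIV_subset] has_real_derivative_poly_sigma) auto
  moreover have "cos x = (1 - h) * (\<tau> / 2 - \<sigma> x)"
    using cos_conv_sigma[of x] one_minus_h_tau by (simp add: right_diff_distrib)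
  moreover have "sin x / (1 - h) * sin x = (1 - h) * (\<sigma> x * (\<tau> - \<sigma> x))"
    using sin_sq_conv_sigma[of x] h_less_1 by (simp add: power2_eq_square field_simps)
  ultimately show ?thesis
    by (simp only: mult.assoc) (simp add: deriv_sin_poly_def algebra_simps)
qed

lemma form_linear_factor: "form s 0 ([:1, -1:] * p) q = form s 1 p q"
  unfolding form_def by (intro integral_cong) (simp add: algebra_simps)

text \<open>The product sin \<theta> p(\<sigma>) q(\<sigma>) vanishes at both ends because pq does
  at 1. The two terms of its derivative carry 1 - h and 1/(1 - h), hence the square. The polynomial
  with the factor 1 - x may be either argument: q for derivatives of p-functions, p for those of
  q-functions.\<close>

lemma form_by_parts:
  assumes "poly (p * q) 1 = 0"
  shows "(1 - h)\<^sup>2 * form 0 0 (deriv_sin_poly p) q = - form 1 0 p (pderiv q)"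
proof -
  let ?F = "\<lambda>x. (sin x * poly p (\<sigma> x)) * poly q (\<sigma> x)"
  let ?f = "\<lambda>x. (1 - h) * (poly (deriv_sin_poly p) (\<sigma> x) * poly q (\<sigma> x) * (1 - \<sigma> x) ^ 0 * sin x ^ (2 * 0))"
  let ?g = "\<lambda>x. 1 / (1 - h) * (poly p (\<sigma> x) * poly (pderiv q) (\<sigma> x) * (1 - \<sigma> x) ^ 0 * sin x ^ (2 * 1))"
  have "(?F has_real_derivative ?f x + ?g x) (at x within S)" for x S
  proof -
    have "(?F has_real_derivative ((1 - h) * poly (deriv_sin_poly p) (\<sigma> x)) * poly q (\<sigma> x)
        + poly (pderiv q) (\<sigma> x) * (sin x / (1 - h)) * (sin x * poly p (\<sigma> x))) (at x within S)"
      by (intro DERIV_mult has_real_derivative_poly_sigma has_real_derivative_sin_poly_sigma)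
    also have "((1 - h) * poly (deriv_sin_poly p) (\<sigma> x)) * poly q (\<sigma> x)
        + poly (pderiv q) (\<sigma> x) * (sin x / (1 - h)) * (sin x * poly p (\<sigma> x)) = ?f x + ?g x"
      by (simp add: power2_eq_square mult_ac)
    finally show ?thesis .
  qed
  then have "((\<lambda>x. ?f x + ?g x) has_integral ?F \<phi> - ?F (- \<phi>)) {-\<phi>..\<phi>}"
    using phi_pos
    by (intro fundamental_theorem_of_calculus) (auto simp flip: has_real_derivative_iff_has_vector_derivative)
  also have "?F \<phi> - ?F (- \<phi>) = 0" using assms by auto
  finally have "integral {-\<phi>..\<phi>} (\<lambda>x. ?f x + ?g x) = 0" by (rule integral_unique)
  also have "integral {-\<phi>..\<phi>} (\<lambda>x. ?f x + ?g x) = integral {-\<phi>..\<phi>} ?f + integral {-\<phi>..\<phi>} ?g"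
    by (intro integral_add integrable_continuous_real continuous_intros)
  also have "integral {-\<phi>..\<phi>} ?f = (1 - h) * form 0 0 (deriv_sin_poly p) q"
    unfolding form_def by (rule integral_mult_right)
  also have "integral {-\<phi>..\<phi>} ?g = 1 / (1 - h) * form 1 0 p (pderiv q)"
    unfolding form_def by (rule integral_mult_right)
  finally have "(1 - h) * ((1 - h) * form 0 0 (deriv_sin_poly p) q + 1 / (1 - h) * form 1 0 p (pderiv q)) = 0"
    by simp
  then show ?thesis using h_less_1 by (simp add: distrib_left power2_eq_square)
qed

text \<open>The product term contributes -1 and the term with \<open>pderiv\<close> contributes -k.
  The value is non-zero when the top coefficient of \<open>p\<close> is, so the degree rises by
  exactly one.\<close>

lemma coeff_deriv_sin_poly:
  assumes "degree p \<le> k"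
  shows "coeff (deriv_sin_poly p) (Suc k) = - real (Suc k) * coeff p k"
proof -
  have z: "coeff p (Suc k) = 0" "coeff p (Suc (Suc k)) = 0" using assms by (auto simp: coeff_eq_0)
  show ?thesis
    using z by (cases k) (simp_all add: deriv_sin_poly_def coeff_pderiv algebra_simps)
qed

lemma degree_deriv_sin_poly: "degree (deriv_sin_poly p) \<le> Suc (degree p)"
proof (rule degree_le, intro allI impI)
  fix i assume i: "Suc (degree p) < i"
  then obtain k where k: "i = Suc k" by (cases i) auto
  then show "coeff (deriv_sin_poly p) i = 0"
    using coeff_deriv_sin_poly[of p k] i by (simp add: coeff_eq_0)
qed

lemma degree_linear_factor_arc_poly: "degree ([:1, -1:] * arc_poly s b k) = Suc k"
  by (subst degree_mult_eq) auto

lemma coeff_linear_factor_arc_poly: "coeff ([:1, -1:] * arc_poly s b k) (Suc k) = - coeff (arc_poly s b k) k"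
  using degree_arc_poly[of s b k] by (simp add: coeff_eq_0)

text \<open>The derivative is sin \<theta> Q'(\<sigma>)/(1 - h), so Q' is expanded in the q family.
  By parts, pairing Q' with \<open>q\<close> becomes pairing \<open>arc_poly 0 1 k\<close> with a
  polynomial of degree at most \<open>degree q + 1\<close>: this is 0 below degree k, and non-zero
  for the monomial of degree k - 1.\<close>

lemma arc_p_m1_derivative:
  assumes "m \<ge> 1"
  obtains c d where "m = 1 \<Longrightarrow> c = 0" "m \<ge> 2 \<Longrightarrow> c \<noteq> 0" "d \<noteq> 0"
    "\<And>x. (arc_p (-1) h m has_real_derivative c * arc_q 0 h (m - 1) x + d * arc_q 0 h m x) (at x)"
proof -
  obtain k where k: "m = Suc k" using assms by (cases m) auto
  define Q where "Q = [:1, -1:] * arc_poly 0 1 k"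
  have degQ: "degree Q = Suc k" and Qk: "coeff Q (Suc k) \<noteq> 0" and Q1: "poly Q 1 = 0"
    unfolding Q_def coeff_linear_factor_arc_poly using degree_linear_factor_arc_poly lead_arc_poly_pos[of 0 1 k] by auto
  have deg: "degree (pderiv Q) \<le> k" using degree_pderiv[of Q] degQ by simp
  have ck: "coeff (pderiv Q) k \<noteq> 0" using Qk by (simp add: coeff_pderiv)
  have "((\<lambda>x. poly Q (\<sigma> x)) has_real_derivative poly (pderiv Q) (\<sigma> x) * (sin x / (1 - h))) (at x)" for x
    by (rule has_real_derivative_poly_sigma)
  moreover have "arc_p (-1) h m = (\<lambda>x. poly Q (\<sigma> x))"
    unfolding Q_def k by (rule ext, subst arc_p_m1) auto
  ultimately have D: "(arc_p (-1) h m has_real_derivative poly (pderiv Q) (\<sigma> x) * (sin x / (1 - h))) (at x)" for x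
    by simp
  have form_pderiv: "form 1 0 (pderiv Q) q = - (1 - h)\<^sup>2 * form 0 1 (arc_poly 0 1 k) (deriv_sin_poly q)" for q
  proof -
    have "form 1 0 (pderiv Q) q = - ((1 - h)\<^sup>2 * form 0 0 (deriv_sin_poly q) Q)"
      using form_by_parts[of q Q] Q1 by (subst form.sym) simp
    also have "form 0 0 (deriv_sin_poly q) Q = form 0 1 (arc_poly 0 1 k) (deriv_sin_poly q)"
      unfolding Q_def by (subst form.sym) (simp add: form_linear_factor del: mult_pCons_left)
    finally show ?thesis by simp
  qed
  have lead1: "coeff (arc_poly 1 0 k) k \<noteq> 0" using lead_arc_poly_pos[of 1 0 k] by simp
  show thesis
  proof (cases k)
    \<comment> \<open>For m = 1 the polynomial Q' is constant and the whole derivative is a multiple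
      of q_1.\<close>
    case 0
    have "pderiv Q = [:coeff (pderiv Q) 0:]"
      using deg 0 by (metis degree_eq_zeroE coeff_pCons_0 le_zero_eq)
    then have pd: "poly (pderiv Q) y = coeff (pderiv Q) 0" for y
      by (metis mult_zero_right poly_0 poly_pCons add.right_neutral)
    show thesis
    proof (rule that)
      show "(arc_p (-1) h m has_real_derivative
          0 * arc_q 0 h (m - 1) x + coeff (pderiv Q) 0 / (1 - h) * arc_q 0 h m x) (at x)" for x
        using D[of x] unfolding pd by (simp add: arc_q_0 k 0)
    qed (use ck h_less_1 k 0 in auto)
  next
    case (Suc j)
    have z: "form 1 0 (pderiv Q) q = 0" if "degree q < j" for q
    proof -
      have "degree (deriv_sin_poly q) < k" using degree_deriv_sin_poly[of q] that Suc by simp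
      then have "form 0 1 (arc_poly 0 1 k) (deriv_sin_poly q) = 0"
        using orth_arc_poly[of 0 1 k] by (simp add: form.orth_def)
      then show ?thesis using form_pderiv[of q] by simp
    qed
    obtain c where c: "pderiv Q = smult c (arc_poly 1 0 j)
          + smult (coeff (pderiv Q) (Suc j) / lead_coeff (arc_poly 1 0 (Suc j))) (arc_poly 1 0 (Suc j))"
      and cnz: "\<And>r. degree r \<le> j \<Longrightarrow> form 1 0 (pderiv Q) r \<noteq> 0 \<Longrightarrow> c \<noteq> 0"
      using form.orth_expand2[OF orth_arc_poly orth_arc_poly, of "pderiv Q" j 1 0] deg z Suc by blast
    define d where "d = coeff (pderiv Q) k / lead_coeff (arc_poly 1 0 k)"
    have "d \<noteq> 0" using ck lead1 by (simp add: d_def)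
    have "degree (deriv_sin_poly (monom 1 j)) \<le> k"
      using degree_deriv_sin_poly[of "monom 1 j"] Suc by (simp add: degree_monom_eq)
    moreover have "coeff (deriv_sin_poly (monom 1 j)) k \<noteq> 0"
      unfolding Suc by (subst coeff_deriv_sin_poly) (auto simp: degree_monom_eq)
    ultimately have "form 0 1 (arc_poly 0 1 k) (deriv_sin_poly (monom 1 j)) \<noteq> 0"
      by (rule form.orth_top_nonzero[OF orth_arc_poly])
    then have "form 1 0 (pderiv Q) (monom 1 j) \<noteq> 0"
      unfolding form_pderiv using h_less_1 by simp
    then have "c \<noteq> 0" by (intro cnz[of "monom 1 j"]) (auto simp: degree_monom_eq)
    have pd: "poly (pderiv Q) y = c * poly (arc_poly 1 0 j) y + d * poly (arc_poly 1 0 k) y" for y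
      by (subst c) (simp add: d_def Suc)
    show thesis
    proof (rule that)
      show "(arc_p (-1) h m has_real_derivative
          c / (1 - h) * arc_q 0 h (m - 1) x + d / (1 - h) * arc_q 0 h m x) (at x)" for x
        using D[of x] unfolding pd by (simp add: arc_q_0 k Suc add_divide_distrib algebra_simps)
    qed (use \<open>c \<noteq> 0\<close> \<open>d \<noteq> 0\<close> h_less_1 k Suc in auto)
  qed
qed

text \<open>Dual to the p case: integration by parts now lowers the degree of the test polynomial,
  so everything up to degree k = m - 2 is annihilated. The function q_1 = sin is excluded, as it
  does not vanish at the ends; the hats take its place.\<close>

lemma arc_q_m1_derivative:
  assumes "m \<ge> 2"
  obtains c d where "c \<noteq> 0" "d \<noteq> 0"
    "\<And>x. (arc_q (-1) h m has_real_derivative c * arc_p 0 h (m - 1) x + d * arc_p 0 h m x) (at x)"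
proof -
  obtain k where k: "m = Suc (Suc k)" using assms by (metis Suc_le_D numeral_2_eq_2 Suc_le_mono)
  define Q where "Q = [:1, -1:] * arc_poly 1 1 k"
  have degQ: "degree Q = Suc k" and Qk: "coeff Q (Suc k) \<noteq> 0" and Q1: "poly Q 1 = 0"
    unfolding Q_def coeff_linear_factor_arc_poly using degree_linear_factor_arc_poly lead_arc_poly_pos[of 1 1 k] by auto
  have deg: "degree (deriv_sin_poly Q) \<le> Suc (Suc k)" using degree_deriv_sin_poly[of Q] degQ by simp
  have ck: "coeff (deriv_sin_poly Q) (Suc (Suc k)) \<noteq> 0" using Qk degQ by (subst coeff_deriv_sin_poly) auto
  have "arc_q (-1) h m = (\<lambda>x. sin x * poly Q (\<sigma> x))"
    unfolding Q_def k by (rule ext, subst arc_q_m1) auto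
  then have D: "(arc_q (-1) h m has_real_derivative (1 - h) * poly (deriv_sin_poly Q) (\<sigma> x)) (at x)" for x
    using has_real_derivative_sin_poly_sigma by simp
  have form_deriv_sin_poly: "(1 - h)\<^sup>2 * form 0 0 (deriv_sin_poly Q) q = - form 1 1 (arc_poly 1 1 k) (pderiv q)" for q
    using form_by_parts[of Q q] Q1 form_linear_factor[of 1 "arc_poly 1 1 k" "pderiv q"]
    by (simp add: Q_def del: mult_pCons_left)
  have z: "form 0 0 (deriv_sin_poly Q) q = 0" if "degree q < Suc k" for q
  proof -
    have "form 1 1 (arc_poly 1 1 k) (pderiv q) = 0"
    \<comment> \<open>For k = 0 truncated subtraction would spoil the degree bound for constants,
      but their derivative is 0.\<close>
    proof (cases "degree q = 0")
      case True
      then have "pderiv q = 0" by (simp add: pderiv_eq_0_iff)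
      then show ?thesis by simp
    next
      case False
      then have "degree (pderiv q) < k" using that by (simp add: degree_pderiv)
      then show ?thesis using orth_arc_poly[of 1 1 k] by (simp add: form.orth_def)
    qed
    then show ?thesis using form_deriv_sin_poly[of q] h_less_1 by simp
  qed
  obtain c where c: "deriv_sin_poly Q = smult c (arc_poly 0 0 (Suc k))
        + smult (coeff (deriv_sin_poly Q) (Suc (Suc k)) / lead_coeff (arc_poly 0 0 (Suc (Suc k)))) (arc_poly 0 0 (Suc (Suc k)))"
    and cnz: "\<And>r. degree r \<le> Suc k \<Longrightarrow> form 0 0 (deriv_sin_poly Q) r \<noteq> 0 \<Longrightarrow> c \<noteq> 0"
    using form.orth_expand2[OF orth_arc_poly orth_arc_poly, of "deriv_sin_poly Q" "Suc k" 0 0] deg z by blast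
  define d where "d = coeff (deriv_sin_poly Q) m / lead_coeff (arc_poly 0 0 m)"
  have "d \<noteq> 0" using ck lead_arc_poly_pos[of 0 0 m] by (simp add: d_def k)
  have "form 1 1 (arc_poly 1 1 k) (pderiv (monom 1 (Suc k))) \<noteq> 0"
    by (rule form.orth_top_nonzero[OF orth_arc_poly]) (auto simp: pderiv_monom degree_monom_eq)
  then have "form 0 0 (deriv_sin_poly Q) (monom 1 (Suc k)) \<noteq> 0"
    using form_deriv_sin_poly[of "monom 1 (Suc k)"] by auto
  then have "c \<noteq> 0" by (intro cnz[of "monom 1 (Suc k)"]) (auto simp: degree_monom_eq)
  have pd: "poly (deriv_sin_poly Q) y = c * poly (arc_poly 0 0 (Suc k)) y + d * poly (arc_poly 0 0 m) y" for y
    by (subst c) (simp add: d_def k)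
  show thesis
  proof (rule that)
    show "(arc_q (-1) h m has_real_derivative
        ((1 - h) * c) * arc_p 0 h (m - 1) x + ((1 - h) * d) * arc_p 0 h m x) (at x)" for x
      using D[of x] unfolding pd by (simp add: arc_p_0 k algebra_simps)
  qed (use \<open>c \<noteq> 0\<close> \<open>d \<noteq> 0\<close> h_less_1 in auto)
qed

section \<open>Uniqueness of the derivative coefficients\<close>

lemma arc_p_conv_arc_fun: "arc_p 0 h m = arc_fun (2 * m)"
  by (rule ext) (simp add: arc_fun_def)

lemma arc_q_conv_arc_fun: "m \<ge> 1 \<Longrightarrow> arc_q 0 h m = arc_fun (2 * m - 1)"
  by (rule ext) (auto simp: arc_fun_def)

lemma arc_fun_pair_independent:
  assumes "K \<noteq> L" "\<And>x. x \<in> {-\<phi><..<\<phi>} \<Longrightarrow> a * arc_fun K x + b * arc_fun L x = a' * arc_fun K x + b' * arc_fun L x"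
  shows "a = a'" "b = b'"
proof -
  define c where "c i = (if i = K then a - a' else b - b')" for i
  have "(\<Sum>i\<in>{K, L}. c i * arc_fun i x) = 0" if "x \<in> {-\<phi><..<\<phi>}" for x
    using assms(1) assms(2)[OF that] by (simp add: c_def algebra_simps)
  then have "c K = 0" "c L = 0"
    using arc_fun_independent[of "{K, L}" c] by auto
  then show "a = a'" "b = b'" using assms(1) by (auto simp: c_def)
qed

lemma arc_p_deriv_coeffs:
  assumes m: "m \<ge> 1"
  shows "m = 1 \<Longrightarrow> fst (arc_p_deriv_coeffs h m) = 0"
    and "m \<ge> 2 \<Longrightarrow> fst (arc_p_deriv_coeffs h m) \<noteq> 0"
    and "snd (arc_p_deriv_coeffs h m) \<noteq> 0"
    and "(arc_p (-1) h m has_real_derivative fst (arc_p_deriv_coeffs h m) * arc_q 0 h (m - 1) x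
            + snd (arc_p_deriv_coeffs h m) * arc_q 0 h m x) (at x)"
proof -
  obtain c d where cd: "m = 1 \<Longrightarrow> c = 0" "m \<ge> 2 \<Longrightarrow> c \<noteq> 0" "d \<noteq> 0"
    "\<And>x. (arc_p (-1) h m has_real_derivative c * arc_q 0 h (m - 1) x + d * arc_q 0 h m x) (at x)"
    using arc_p_m1_derivative[OF m] by metis
  have "arc_p_deriv_coeffs h m = (c, d)"
    unfolding arc_p_deriv_coeffs_def arccos_h
  proof (rule the_equality)
    fix y assume y: "(m = 1 \<longrightarrow> fst y = 0) \<and> (\<forall>x\<in>{-\<phi><..<\<phi>}.
        (arc_p (-1) h m has_real_derivative fst y * arc_q 0 h (m - 1) x + snd y * arc_q 0 h m x) (at x))"
    then have eq: "fst y * arc_q 0 h (m - 1) x + snd y * arc_q 0 h m x = c * arc_q 0 h (m - 1) x + d * arc_q 0 h m x"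
      if "x \<in> {-\<phi><..<\<phi>}" for x
      using DERIV_unique[OF _ cd(4)] that by blast
    have "fst y = c \<and> snd y = d"
    proof (cases "m = 1")
      case True
      \<comment> \<open>The first coefficient multiplies the zero function, and only the convention
        that it is 0 fixes it. \<open>arc_fun 0\<close> with coefficient 0 serves as the second
        function that the independence lemma expects.\<close>
      then have "snd y = d"
        using arc_fun_pair_independent(1)[of 1 0 "snd y" 0 d 0] eq arc_q_conv_arc_fun[of 1]
        by (simp add: arc_q_def[of _ _ 0])
      then show ?thesis using True y cd(1) by simp
    next
      case False
      then have "2 * (m - 1) - 1 \<noteq> 2 * m - 1" "m - 1 \<ge> 1" using m by auto
      then show ?thesis
        using arc_fun_pair_independent[of "2 * (m - 1) - 1" "2 * m - 1" "fst y" "snd y" c d] eq m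
        by (simp add: arc_q_conv_arc_fun)
    qed
    then show "y = (c, d)" by (simp add: prod_eq_iff)
  qed (use cd in auto)
  then show "m = 1 \<Longrightarrow> fst (arc_p_deriv_coeffs h m) = 0"
    and "m \<ge> 2 \<Longrightarrow> fst (arc_p_deriv_coeffs h m) \<noteq> 0"
    and "snd (arc_p_deriv_coeffs h m) \<noteq> 0"
    and "(arc_p (-1) h m has_real_derivative fst (arc_p_deriv_coeffs h m) * arc_q 0 h (m - 1) x
            + snd (arc_p_deriv_coeffs h m) * arc_q 0 h m x) (at x)"
    using cd by auto
qed

lemma arc_q_deriv_coeffs:
  assumes m: "m \<ge> 2"
  shows "fst (arc_q_deriv_coeffs h m) \<noteq> 0"
    and "snd (arc_q_deriv_coeffs h m) \<noteq> 0"
    and "(arc_q (-1) h m has_real_derivative fst (arc_q_deriv_coeffs h m) * arc_p 0 h (m - 1) x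
            + snd (arc_q_deriv_coeffs h m) * arc_p 0 h m x) (at x)"
proof -
  obtain c d where cd: "c \<noteq> 0" "d \<noteq> 0"
    "\<And>x. (arc_q (-1) h m has_real_derivative c * arc_p 0 h (m - 1) x + d * arc_p 0 h m x) (at x)"
    using arc_q_m1_derivative[OF m] by metis
  have "arc_q_deriv_coeffs h m = (c, d)"
    unfolding arc_q_deriv_coeffs_def arccos_h
  proof (rule the_equality)
    fix y assume y: "\<forall>x\<in>{-\<phi><..<\<phi>}.
        (arc_q (-1) h m has_real_derivative fst y * arc_p 0 h (m - 1) x + snd y * arc_p 0 h m x) (at x)"
    then have eq: "fst y * arc_p 0 h (m - 1) x + snd y * arc_p 0 h m x = c * arc_p 0 h (m - 1) x + d * arc_p 0 h m x"
      if "x \<in> {-\<phi><..<\<phi>}" for x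
      using DERIV_unique[OF _ cd(3)] that by blast
    have "2 * (m - 1) \<noteq> 2 * m" using m by auto
    then have "fst y = c \<and> snd y = d"
      using arc_fun_pair_independent[of "2 * (m - 1)" "2 * m" "fst y" "snd y" c d] eq
      by (simp add: arc_p_conv_arc_fun)
    then show "y = (c, d)" by (simp add: prod_eq_iff)
  qed (use cd in auto)
  then show "fst (arc_q_deriv_coeffs h m) \<noteq> 0"
    and "snd (arc_q_deriv_coeffs h m) \<noteq> 0"
    and "(arc_q (-1) h m has_real_derivative fst (arc_q_deriv_coeffs h m) * arc_p 0 h (m - 1) x
            + snd (arc_q_deriv_coeffs h m) * arc_p 0 h m x) (at x)"
    using cd by auto
qed

section \<open>The slope of the hat functions\<close>

text \<open>The coefficients of \<open>cos \<theta> / (2 sin \<phi>)\<close>, the slope of the hat functions, come from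
  \<open>cos \<theta> = 1 - (1 - h) \<sigma>\<close> and from solving \<open>p\<^sub>1\<close> for \<open>\<sigma>\<close>.\<close>

definition hat_coef :: "nat \<Rightarrow> real" where
  "hat_coef K =
     (if K = 0 then (1 + (1 - h) * coeff (arc_poly 0 0 1) 0 / coeff (arc_poly 0 0 1) 1) / (2 * sin \<phi>)
      else if K = 2 then - (1 - h) / (coeff (arc_poly 0 0 1) 1 * (2 * sin \<phi>))
      else 0)"

lemma poly_arc_poly_1: "poly (arc_poly s b 1) y = coeff (arc_poly s b 1) 0 + coeff (arc_poly s b 1) 1 * y"
  by (simp add: poly_altdef)

lemma hat_coef_expansion: "(\<Sum>K\<le>2. hat_coef K * arc_fun K x) = cos x / (2 * sin \<phi>)"
proof -
  define B A where "B = coeff (arc_poly 0 0 1) 1" and "A = coeff (arc_poly 0 0 1) 0"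
  have B: "B > 0" unfolding B_def by (rule lead_arc_poly_pos)
  have "arc_fun 0 x = 1" by (simp add: arc_fun_altdef)
  moreover have "arc_fun 2 x = A + B * \<sigma> x" using poly_arc_poly_1[of 0 0 "\<sigma> x"] by (simp add: arc_fun_altdef A_def B_def)
  ultimately have "(\<Sum>K\<le>2. hat_coef K * arc_fun K x) =
      (1 + (1 - h) * A / B) / (2 * sin \<phi>) + - (1 - h) / (B * (2 * sin \<phi>)) * (A + B * \<sigma> x)"
    by (simp add: numeral_2_eq_2 hat_coef_def A_def B_def)
  also have "\<dots> = (1 - (1 - h) * \<sigma> x) / (2 * sin \<phi>)"
    using B sin_phi_pos by (simp add: field_simps)
  also have "\<dots> = cos x / (2 * sin \<phi>)" by (simp only: cos_conv_sigma[of x])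
  finally show ?thesis .
qed

text \<open>Thanks to this, the entries of the hat matrices are elementary integrals and the squared
  norms never have to be evaluated.\<close>

lemma integral_arc_fun_cos:
  "integral {-\<phi>..\<phi>} (\<lambda>x. arc_fun K x * (cos x / (2 * sin \<phi>))) = hat_coef K * arc_sqnorm K"
  using integral_sum_arc_fun[of "{..2}" hat_coef K] unfolding hat_coef_expansion
  by (simp add: mult.commute hat_coef_def)

lemma integral_cos: "integral {-\<phi>..\<phi>} (\<lambda>x. cos x / (2 * sin \<phi>)) = 1"
proof -
  have "((\<lambda>x. cos x / (2 * sin \<phi>)) has_integral sin \<phi> / (2 * sin \<phi>) - sin (- \<phi>) / (2 * sin \<phi>)) {-\<phi>..\<phi>}"
    using phi_pos sin_phi_pos
    by (intro fundamental_theorem_of_calculus)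
      (auto simp flip: has_real_derivative_iff_has_vector_derivative intro!: derivative_eq_intros)
  moreover have "sin \<phi> / (2 * sin \<phi>) - sin (- \<phi>) / (2 * sin \<phi>) = 1"
    using sin_phi_pos by (simp add: divide_simps)
  ultimately show ?thesis by (metis integral_unique)
qed

lemma hat_coef_0: "hat_coef 0 * arc_sqnorm 0 = 1"
  using integral_arc_fun_cos[of 0] integral_cos by (simp add: arc_fun_altdef)

text \<open>The number \<open>zeta\<close> of an element, with h csc(l) replaced by the value 1/(2
  sin \<phi>) that it has for every length l = 2\<phi>.\<close>

definition arc_zeta :: real where
  "arc_zeta = 1 / (2 * sin \<phi>) * sj_beta \<tau> (-1/2) 0 (-1/2) *
     (sin \<phi> * (2 * sj_alpha \<tau> (-1/2) 0 (-1/2) - 1) - (sin \<phi> - \<phi>) / (1 - h))"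

text \<open>The minus sign belongs to the rising half of a hat; a hat falls on the element with its
  own index, which puts +\<zeta> on the diagonal.\<close>

lemma hat_coef_2: "hat_coef 2 * arc_sqnorm 2 = - arc_zeta"
proof -
  define B A where "B = coeff (arc_poly 0 0 1) 1" and "A = coeff (arc_poly 0 0 1) 0"
  have B: "B > 0" unfolding B_def by (rule lead_arc_poly_pos)
  have h: "1 - h > 0" using h_less_1 by simp
  \<comment> \<open>An antiderivative of (A + B\<sigma>) cos / (2 sin \<phi>), with (x + sin x cos
    x)/2 integrating the squared cosine.\<close>
  let ?F = "\<lambda>x. (A * sin x + B / (1 - h) * (sin x - (x + sin x * cos x) / 2)) / (2 * sin \<phi>)"
  have "hat_coef 2 * arc_sqnorm 2 = integral {-\<phi>..\<phi>} (\<lambda>x. arc_fun 2 x * (cos x / (2 * sin \<phi>)))"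
    by (rule integral_arc_fun_cos[symmetric])
  also have "\<dots> = ?F \<phi> - ?F (- \<phi>)"
  proof (rule integral_unique, rule fundamental_theorem_of_calculus)
    fix x
    have "arc_fun 2 x = A + B * \<sigma> x" using poly_arc_poly_1[of 0 0 "\<sigma> x"] by (simp add: arc_fun_altdef A_def B_def)
    moreover have "\<sigma> x = (1 - cos x) / (1 - h)" using one_minus_cos[of x] h by simp
    moreover have "((\<lambda>x. sin x - (x + sin x * cos x) / 2) has_real_derivative
        cos x - (1 + (cos x * cos x - sin x * sin x)) / 2) (at x within {-\<phi>..\<phi>})"
      by (auto intro!: derivative_eq_intros simp: field_simps)
    then have "(?F has_real_derivative
        (A * cos x + B / (1 - h) * (cos x - (1 + (cos x * cos x - sin x * sin x)) / 2)) / (2 * sin \<phi>))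
        (at x within {-\<phi>..\<phi>})"
      by (intro DERIV_cdivide DERIV_add DERIV_cmult DERIV_sin[THEN DERIV_subset]) auto
    moreover have "1 + (cos x * cos x - sin x * sin x) = 2 * (cos x * cos x)"
      using sin_cos_squared_add[of x] by (simp add: power2_eq_square algebra_simps)
    moreover have "B / (1 - h) * (cos x - 2 * (cos x * cos x) / 2) = B * ((1 - cos x) / (1 - h)) * cos x"
      by (simp add: algebra_simps diff_divide_distrib)
    then have "(A * cos x + B / (1 - h) * (cos x - 2 * (cos x * cos x) / 2)) / (2 * sin \<phi>) =
        (A + B * ((1 - cos x) / (1 - h))) * (cos x / (2 * sin \<phi>))"
      by (simp add: distrib_right)
    ultimately have "(?F has_real_derivative arc_fun 2 x * (cos x / (2 * sin \<phi>))) (at x within {-\<phi>..\<phi>})"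
      by metis
    then show "(?F has_vector_derivative arc_fun 2 x * (cos x / (2 * sin \<phi>))) (at x within {-\<phi>..\<phi>})"
      by (simp add: has_real_derivative_iff_has_vector_derivative)
  qed (use phi_pos in auto)
  also have "\<dots> = (2 * A * sin \<phi> + B / (1 - h) * (2 * sin \<phi> - \<phi> - sin \<phi> * h)) / (2 * sin \<phi>)"
  proof -
    define k where "k = B / (1 - h)"
    show ?thesis
      unfolding k_def[symmetric] diff_divide_distrib[symmetric] using sin_phi_pos by (simp add: field_simps)
  qed
  also have "B / (1 - h) * (2 * sin \<phi> - \<phi> - sin \<phi> * h) = B * ((sin \<phi> - \<phi>) / (1 - h) + sin \<phi>)"
  proof -
    \<comment> \<open>Splitting off (1 - h) sin \<phi> leaves the sin \<phi> - \<phi> of the stated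
      formula.\<close>
    have "2 * sin \<phi> - \<phi> - sin \<phi> * h = (1 - h) * ((sin \<phi> - \<phi>) / (1 - h) + sin \<phi>)"
      unfolding distrib_left times_divide_eq_right nonzero_mult_div_cancel_left[OF h[THEN less_imp_neq, symmetric]]
      by (simp add: algebra_simps)
    then show ?thesis using h by simp
  qed
  also have "2 * A * sin \<phi> + B * ((sin \<phi> - \<phi>) / (1 - h) + sin \<phi>) =
      - (B * (sin \<phi> * (2 * (- A / B) - 1) - (sin \<phi> - \<phi>) / (1 - h)))"
    using B by (simp add: right_diff_distrib distrib_left)
  also have "\<dots> / (2 * sin \<phi>) = - (1 / (2 * sin \<phi>) * B * (sin \<phi> * (2 * (- A / B) - 1) - (sin \<phi> - \<phi>) / (1 - h)))"
    by simp
  finally show ?thesis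
    by (simp add: arc_zeta_def sj_beta_def sj_alpha_def A_def B_def arc_poly_def)
qed

section \<open>The differentiation matrix of a single element\<close>

text \<open>Both indices are block positions: column J is p_m with m = (J + 1)/2 for odd J and q_m
  with m = J/2 + 1 for even J > 0. Besides K = J, odd columns reach up to J - 2 and even ones down
  to J + 2; the hats fit the even pattern.\<close>

definition dcoef :: "nat \<Rightarrow> nat \<Rightarrow> real" where
  "dcoef K J =
     (if J = 0 then hat_coef K
      else if odd J then
        (if K = J then arc_d_p h ((J + 1) div 2) ((J + 1) div 2 + 1)
         else if K + 2 = J then arc_d_p h ((J + 1) div 2 - 1) ((J + 1) div 2 + 1) else 0)
      else
        (if K = J then arc_d_q h (J div 2 + 1) (J div 2 + 1)
         else if K = J + 2 then arc_d_q h (J div 2 + 2) (J div 2 + 1) else 0))"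

lemma dcoef_nonzero_iff:
  "dcoef K J \<noteq> 0 \<longleftrightarrow> K = J \<or> (odd J \<and> K + 2 = J) \<or> (even J \<and> K = J + 2)"
proof (cases "J = 0")
  case True
  \<comment> \<open>The defining formula does not show this; the product with the squared norm being
    1 does.\<close>
  have "hat_coef 0 \<noteq> 0" using hat_coef_0 by auto
  moreover have "hat_coef 2 \<noteq> 0"
    using h_less_1 sin_phi_pos lead_arc_poly_pos[of 0 0 1] by (simp add: hat_coef_def)
  ultimately show ?thesis using True by (auto simp: dcoef_def hat_coef_def)
next
  case False
  show ?thesis
  proof (cases "odd J")
    case True
    then obtain k where k: "J = 2 * k + 1" by (rule oddE)
    have "snd (arc_p_deriv_coeffs h (k + 1)) \<noteq> 0" by (rule arc_p_deriv_coeffs) simp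
    moreover have "fst (arc_p_deriv_coeffs h (k + 1)) \<noteq> 0" if "K + 2 = J"
      using that k by (intro arc_p_deriv_coeffs) auto
    moreover have "k \<ge> 1" if "K + 2 = J" using that k by simp
    ultimately show ?thesis using k by (auto simp: dcoef_def arc_d_p_def)
  next
    case even: False
    then obtain k where k: "J = 2 * k" by (auto elim: evenE)
    have "fst (arc_q_deriv_coeffs h (k + 1)) \<noteq> 0" "snd (arc_q_deriv_coeffs h (k + 1)) \<noteq> 0"
      using False k by (auto intro!: arc_q_deriv_coeffs)
    then show ?thesis using False k by (auto simp: dcoef_def arc_d_q_def)
  qed
qed

text \<open>Index 0 is the odd part of a rising hat half; the constant 1/2 is left out since
  differentiation removes it.\<close>

definition arc_fun_m1 :: "nat \<Rightarrow> real \<Rightarrow> real" where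
  "arc_fun_m1 J x =
     (if J = 0 then sin x / (2 * sin \<phi>)
      else if odd J then arc_p (-1) h ((J + 1) div 2) x
      else arc_q (-1) h (J div 2 + 1) x)"

lemma arc_fun_m1_has_derivative:
  "(arc_fun_m1 J has_real_derivative (\<Sum>K\<le>J+2. dcoef K J * arc_fun K x)) (at x)"
proof (cases "J = 0")
  case True
  have "((\<lambda>x. sin x / (2 * sin \<phi>)) has_real_derivative cos x / (2 * sin \<phi>)) (at x)"
    by (intro DERIV_cdivide DERIV_sin)
  moreover have "(\<Sum>K\<le>J+2. dcoef K J * arc_fun K x) = cos x / (2 * sin \<phi>)"
    unfolding True dcoef_def using hat_coef_expansion[of x] by (simp only: add_0 if_True simp_thms)
  ultimately show ?thesis using True by (simp add: arc_fun_m1_def[abs_def])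
next
  case False
  show ?thesis
  proof (cases "odd J")
    case True
    then obtain k where k: "J = 2 * k + 1" by (rule oddE)
    have "(\<Sum>K\<le>J+2. dcoef K J * arc_fun K x) = (\<Sum>K\<in>{J} \<union> {K. K + 2 = J}. dcoef K J * arc_fun K x)"
    proof (intro sum.mono_neutral_right ballI)
      show "dcoef K J * arc_fun K x = 0" if "K \<in> {..J + 2} - ({J} \<union> {K. K + 2 = J})" for K
        using that dcoef_nonzero_iff[of K J] True by auto
    qed auto
    also have "\<dots> = fst (arc_p_deriv_coeffs h (k + 1)) * arc_q 0 h k x
        + snd (arc_p_deriv_coeffs h (k + 1)) * arc_q 0 h (k + 1) x"
    proof (cases k)
      case 0
      \<comment> \<open>For J = 1 no position J - 2 exists: this is the absent q_0.\<close>
      then have "{J} \<union> {K. K + 2 = J} = {1}" using k by auto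
      then show ?thesis using 0 k by (simp add: dcoef_def arc_d_p_def arc_q_conv_arc_fun arc_q_def[of _ _ 0])
    next
      case (Suc j)
      then have "{J} \<union> {K. K + 2 = J} = {2 * j + 1, J}" using k by auto
      then show ?thesis using Suc k by (simp add: dcoef_def arc_d_p_def arc_q_conv_arc_fun)
    qed
    moreover have "arc_fun_m1 J = arc_p (-1) h (k + 1)" using k by (simp add: arc_fun_m1_def[abs_def])
    ultimately show ?thesis using arc_p_deriv_coeffs(4)[of "k + 1" x] by simp
  next
    case even: False
    then obtain k where k: "J = 2 * k" by (auto elim: evenE)
    have "(\<Sum>K\<le>J+2. dcoef K J * arc_fun K x) = (\<Sum>K\<in>{J, J + 2}. dcoef K J * arc_fun K x)"
    proof (intro sum.mono_neutral_right ballI)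
      show "dcoef K J * arc_fun K x = 0" if "K \<in> {..J + 2} - {J, J + 2}" for K
        using that dcoef_nonzero_iff[of K J] even by auto
    qed auto
    also have "\<dots> = fst (arc_q_deriv_coeffs h (k + 1)) * arc_p 0 h k x
        + snd (arc_q_deriv_coeffs h (k + 1)) * arc_p 0 h (k + 1) x"
      using k False by (simp add: dcoef_def arc_d_q_def arc_p_conv_arc_fun)
    finally show ?thesis using arc_q_deriv_coeffs(3)[of "k + 1" x] k False
      by (simp add: arc_fun_m1_def[abs_def])
  qed
qed

end

section \<open>Piecewise bases on a grid\<close>

lemma infsum_eq_sum:
  fixes f :: "'a \<Rightarrow> real"
  assumes "finite S" "\<And>x. x \<notin> S \<Longrightarrow> f x = 0"
  shows "(\<Sum>\<^sub>\<infinity>x. f x) = sum f S"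
proof -
  have "(\<Sum>\<^sub>\<infinity>x. f x) = (\<Sum>\<^sub>\<infinity>x\<in>S. f x)"
    by (rule infsum_cong_neutral) (use assms in auto)
  then show ?thesis using assms by simp
qed

lemma mat_eqD: "mat_eq n A B \<Longrightarrow> i \<in> {1..n} \<Longrightarrow> j \<in> {1..n} \<Longrightarrow> A i j = B i j"
  by (simp add: mat_eq_def)

text \<open>The sign with which the \<open>j\<close>-th function of block \<open>J\<close> enters on element \<open>e\<close>: the hat
  function \<open>j\<close> falls on element \<open>j\<close> and rises on the preceding one.\<close>

definition elem_sign :: "nat \<Rightarrow> nat \<Rightarrow> nat \<Rightarrow> nat \<Rightarrow> real" where
  "elem_sign n J e j =
     (if J = 0 then (if j = e then - 1 else if e = cyc_pred n j then 1 else 0)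
      else if e = j then 1 else 0)"

lemma elem_sign_diag: "elem_sign n J e e \<noteq> 0"
  by (simp add: elem_sign_def)

text \<open>On each element a basis function is, up to a constant, a signed copy of
  \<open>arc_fun_m1 J\<close>, so the sign factors out of the single-element coefficients.\<close>

definition diff_coef :: "nat \<Rightarrow> (nat \<Rightarrow> real) \<Rightarrow> block_matrix" where
  "diff_coef n \<theta> K J e j =
     (if e \<in> {1..n} \<and> j \<in> {1..n} then elem_sign n J e j * arc.dcoef (elem_phi \<theta> e) K J else 0)"

section \<open>Geometry of the grid and restriction of the bases to elements\<close>

locale grid =
  fixes n :: nat and \<theta> :: "nat \<Rightarrow> real"
  assumes n_ge_2: "n \<ge> 2"
    and theta_first: "\<theta> 1 = - pi" and theta_last: "\<theta> (n + 1) = pi"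
    and theta_Suc: "\<forall>i\<in>{1..n}. \<theta> i < \<theta> (i + 1)"
begin

lemma theta_less:
  assumes "1 \<le> i" "i < j" "j \<le> n + 1"
  shows "\<theta> i < \<theta> j"
proof -
  have "i < j \<Longrightarrow> j \<le> n + 1 \<Longrightarrow> \<theta> i < \<theta> j"
  proof (induction j)
    case (Suc j)
    have step: "\<theta> j < \<theta> (Suc j)" using theta_Suc Suc.prems assms(1) by auto
    then show ?case using Suc by (cases "i = j") auto
  qed simp
  then show ?thesis using assms by simp
qed

lemma theta_le: "1 \<le> i \<Longrightarrow> i \<le> j \<Longrightarrow> j \<le> n + 1 \<Longrightarrow> \<theta> i \<le> \<theta> j"
  using theta_less[of i j] by (cases "i = j") auto

text \<open>With n \<ge> 2 there is always a second element, so no element fills the whole circle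
  and the half-width stays strictly below \<pi>.\<close>

lemma arc_elem:
  assumes e: "e \<in> {1..n}"
  shows "arc (elem_phi \<theta> e)"
proof
  show "0 < elem_phi \<theta> e" using theta_Suc e by (auto simp: elem_phi_def elem_len_def)
  have "\<theta> 1 \<le> \<theta> e" "\<theta> (e + 1) \<le> \<theta> (n + 1)" using e by (auto intro!: theta_le)
  moreover have "\<theta> 1 < \<theta> e \<or> \<theta> (e + 1) < \<theta> (n + 1)"
    using e n_ge_2 theta_less[of 1 e] theta_less[of "e + 1" "n + 1"] by (cases "e = 1") auto
  ultimately show "elem_phi \<theta> e < pi"
    using theta_first theta_last by (auto simp: elem_phi_def elem_len_def)
qed

lemma elem_iff:
  assumes "x \<in> {\<theta> e<..<\<theta> (e + 1)}" "e \<in> {1..n}" "k \<in> {1..n}"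
  shows "x \<in> elem \<theta> k \<longleftrightarrow> k = e"
proof -
  have "\<theta> (k + 1) \<le> \<theta> e" if "k < e" using that assms by (intro theta_le) auto
  moreover have "\<theta> (e + 1) \<le> \<theta> k" if "e < k" using that assms by (intro theta_le) auto
  ultimately show ?thesis using assms(1) by (force simp: elem_def not_less_iff_gr_or_eq)
qed

lemma elem_shift_mem:
  "x \<in> {\<theta> e<..<\<theta> (e + 1)} \<longleftrightarrow> elem_shift \<theta> e x \<in> {- elem_phi \<theta> e<..<elem_phi \<theta> e}"
  by (auto simp: elem_shift_def elem_phi_def elem_len_def field_simps)

lemma cyc_pred_mem: "j \<in> {1..n} \<Longrightarrow> cyc_pred n j \<in> {1..n}" and cyc_pred_neq: "cyc_pred n j \<noteq> j \<or> j = 0"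
  using n_ge_2 by (auto simp: cyc_pred_def)

lemma pw_arc_interior:
  assumes "x \<in> {\<theta> e<..<\<theta> (e + 1)}" "e \<in> {1..n}" "k \<in> {1..n}"
  shows "pw_arc b \<theta> m j k x =
    (if k = e then (if j = 1 then arc_q b (elem_h \<theta> e) m (elem_shift \<theta> e x)
                    else arc_p b (elem_h \<theta> e) m (elem_shift \<theta> e x)) else 0)"
  using elem_iff[OF assms] by (simp add: pw_arc_def)

lemma basis0_interior:
  assumes "x \<in> {\<theta> e<..<\<theta> (e + 1)}" "e \<in> {1..n}" "k \<in> {1..n}"
  shows "basis0 \<theta> K k x = (if k = e then arc.arc_fun (elem_phi \<theta> e) K (elem_shift \<theta> e x) else 0)"
proof -
  have "basis0 \<theta> K k x =
      (if even K then pw_arc 0 \<theta> (K div 2) 2 k x else pw_arc 0 \<theta> ((K + 1) div 2) 1 k x)"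
    by (simp add: basis0_def)
  then show ?thesis
    unfolding pw_arc_interior[OF assms] arc.arc_fun_def[OF arc_elem[OF assms(2)]]
    by (simp add: elem_h_def)
qed

text \<open>On each of its two elements, which are distinct even for n = 2, a hat is 1/2 plus or
  minus \<open>arc_fun_m1 0\<close>; the absolute value of the sign marks where the constant
  occurs.\<close>

lemma basism1_interior:
  assumes x: "x \<in> {\<theta> e<..<\<theta> (e + 1)}" and e: "e \<in> {1..n}" and j: "j \<in> {1..n}"
  shows "basism1 n \<theta> J j x = (if J = 0 then \<bar>elem_sign n J e j\<bar> / 2 else 0) +
     elem_sign n J e j * arc.arc_fun_m1 (elem_phi \<theta> e) J (elem_shift \<theta> e x)"
proof (cases "J = 0")
  case True
  have "cyc_pred n j \<noteq> j" using cyc_pred_neq j by auto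
  moreover have "x \<in> elem \<theta> (cyc_pred n j) \<longleftrightarrow> cyc_pred n j = e" "x \<in> elem \<theta> j \<longleftrightarrow> j = e"
    using elem_iff[OF x e] cyc_pred_mem[OF j] j by auto
  ultimately show ?thesis
    using True by (auto simp: basism1_def hat_def Let_def elem_sign_def arc.arc_fun_m1_def[OF arc_elem[OF e]] add_divide_distrib diff_divide_distrib)
next
  case False
  then show ?thesis
    by (simp add: basism1_def pw_arc_interior[OF x e j] elem_sign_def arc.arc_fun_m1_def[OF arc_elem[OF e]] elem_h_def)
qed

definition local_deriv :: "nat \<Rightarrow> nat \<Rightarrow> nat \<Rightarrow> real \<Rightarrow> real" where
  "local_deriv J e j y =
     (\<Sum>K\<le>J+2. elem_sign n J e j * arc.dcoef (elem_phi \<theta> e) K J * arc.arc_fun (elem_phi \<theta> e) K y)"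

lemma basism1_has_derivative:
  assumes x: "x \<in> {\<theta> e<..<\<theta> (e + 1)}" and e: "e \<in> {1..n}" and j: "j \<in> {1..n}"
  shows "(basism1 n \<theta> J j has_real_derivative local_deriv J e j (elem_shift \<theta> e x)) (at x)"
proof -
  interpret arc "elem_phi \<theta> e" by (rule arc_elem[OF e])
  have "(elem_shift \<theta> e has_real_derivative 1) (at x)"
    unfolding elem_shift_def[abs_def] by (auto intro!: derivative_eq_intros)
  from DERIV_chain2[OF arc_fun_m1_has_derivative this, of J]
  have "((\<lambda>x. (if J = 0 then \<bar>elem_sign n J e j\<bar> / 2 else 0) + elem_sign n J e j * arc_fun_m1 J (elem_shift \<theta> e x))
      has_real_derivative 0 + elem_sign n J e j * ((\<Sum>K\<le>J+2. dcoef K J * arc_fun K (elem_shift \<theta> e x)) * 1)) (at x)"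
    by (intro DERIV_add DERIV_const DERIV_cmult)
  moreover have "0 + elem_sign n J e j * ((\<Sum>K\<le>J+2. dcoef K J * arc_fun K (elem_shift \<theta> e x)) * 1) =
      local_deriv J e j (elem_shift \<theta> e x)"
    by (simp add: local_deriv_def sum_distrib_left mult.assoc del: sum.atMost_Suc)
  ultimately have "((\<lambda>x. (if J = 0 then \<bar>elem_sign n J e j\<bar> / 2 else 0) + elem_sign n J e j * arc_fun_m1 J (elem_shift \<theta> e x))
      has_real_derivative local_deriv J e j (elem_shift \<theta> e x)) (at x)" by metis
  then show ?thesis
    by (rule has_field_derivative_transform_within_open[OF _ open_greaterThanLessThan x])
      (rule basism1_interior[OF _ e j, symmetric])
qed

lemma pw_deriv_interior:
  assumes x: "x \<in> {\<theta> e<..<\<theta> (e + 1)}" and e: "e \<in> {1..n}" and j: "j \<in> {1..n}"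
  shows "pw_deriv n \<theta> (basism1 n \<theta> J j) x = local_deriv J e j (elem_shift \<theta> e x)"
  using DERIV_imp_deriv[OF basism1_has_derivative[OF assms]] x e by (auto simp: pw_deriv_def)

lemma grid_interior_exists:
  assumes "\<theta> 1 < x" "x < \<theta> (n + 1)" "x \<notin> \<theta> ` {1..n+1}"
  obtains e where "e \<in> {1..n}" "x \<in> {\<theta> e<..<\<theta> (e + 1)}"
proof -
  have "x < \<theta> (k + 1) \<Longrightarrow> k \<le> n \<Longrightarrow> \<exists>e\<in>{1..k}. x \<in> {\<theta> e<..<\<theta> (e + 1)}" for k
  proof (induction k)
    case 0
    then show ?case using assms by simp
  next
    case (Suc k)
    show ?case
    proof (cases "x < \<theta> (k + 1)")
      case True
      then show ?thesis using Suc by fastforce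
    next
      case False
      have "x \<noteq> \<theta> (k + 1)" using assms(3) Suc.prems by auto
      then show ?thesis using False Suc.prems by (intro bexI[of _ "Suc k"]) auto
    qed
  qed
  then show thesis using assms(2) that by blast
qed

text \<open>The grid nodes form a null set, so overlaps of closed elements and values of
  \<open>pw_deriv\<close> at nodes do not matter. Each remaining integral is shifted to the
  symmetric interval of its element.\<close>

lemma L2_inner_split:
  assumes fg: "\<And>e x. e \<in> {1..n} \<Longrightarrow> x \<in> {\<theta> e<..<\<theta> (e + 1)} \<Longrightarrow> f x * g x = F e (elem_shift \<theta> e x)"
    and cont: "\<And>e. e \<in> {1..n} \<Longrightarrow> continuous_on UNIV (F e)"
  shows "L2_inner f g = (\<Sum>e=1..n. integral {- elem_phi \<theta> e..elem_phi \<theta> e} (F e))"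
proof -
  have "L2_inner f g = (LBINT x. indicator {-pi<..<pi} x *\<^sub>R (f x * g x))"
    by (simp add: L2_inner_def set_lebesgue_integral_def)
  also have "\<dots> = (LBINT x. \<Sum>e=1..n. indicator {\<theta> e..\<theta> (e + 1)} x *\<^sub>R F e (elem_shift \<theta> e x))"
  proof (rule integral_discrete_difference[where X="\<theta> ` {1..n+1}"])
    fix x assume x: "x \<notin> \<theta> ` {1..n+1}"
    show "indicator {-pi<..<pi} x *\<^sub>R (f x * g x) =
        (\<Sum>e=1..n. indicator {\<theta> e..\<theta> (e + 1)} x *\<^sub>R F e (elem_shift \<theta> e x))"
    proof (cases "x \<in> {-pi<..<pi}")
      case True
      then obtain e where e: "e \<in> {1..n}" "x \<in> {\<theta> e<..<\<theta> (e + 1)}"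
        using grid_interior_exists[of x] x theta_first theta_last by auto
      have "(\<Sum>k=1..n. indicator {\<theta> k..\<theta> (k + 1)} x *\<^sub>R F k (elem_shift \<theta> k x)) =
          (\<Sum>k=1..n. if k = e then F e (elem_shift \<theta> e x) else 0)"
        using elem_iff[OF e(2,1)] by (intro sum.cong refl) (auto simp: elem_def indicator_def)
      also have "\<dots> = f x * g x" using fg[OF e] e(1) by simp
      finally show ?thesis using True by simp
    next
      case False
      have "indicator {\<theta> k..\<theta> (k + 1)} x = (0::real)" if k: "k \<in> {1..n}" for k
      proof -
        have "\<theta> 1 \<le> \<theta> k" "\<theta> (k + 1) \<le> \<theta> (n + 1)" using k by (auto intro!: theta_le)
        moreover have "x \<noteq> \<theta> 1" "x \<noteq> \<theta> (n + 1)" using x by auto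
        ultimately show ?thesis using False theta_first theta_last by (auto simp: indicator_def)
      qed
      then show ?thesis using False by simp
    qed
  qed auto
  also have "\<dots> = (\<Sum>e=1..n. LBINT x:{\<theta> e..\<theta> (e + 1)}. F e (elem_shift \<theta> e x))"
    unfolding set_lebesgue_integral_def
    by (intro Bochner_Integration.integral_sum borel_integrable_atLeastAtMost'[unfolded set_integrable_def])
      (auto simp: elem_shift_def intro!: continuous_intros continuous_on_compose2[OF cont])
  also have "\<dots> = (\<Sum>e=1..n. integral {- elem_phi \<theta> e..elem_phi \<theta> e} (F e))"
  proof (intro sum.cong refl)
    fix e assume e: "e \<in> {1..n}"
    define c where "c = - ((\<theta> e + \<theta> (e + 1)) / 2)"
    have shift: "(\<lambda>x. F e (elem_shift \<theta> e x)) = F e \<circ> ((+) c)"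
      by (auto simp: elem_shift_def c_def)
    have "(LBINT x:{\<theta> e..\<theta> (e + 1)}. F e (elem_shift \<theta> e x)) =
        integral {\<theta> e..\<theta> (e + 1)} (\<lambda>x. F e (elem_shift \<theta> e x))"
      by (intro set_borel_integral_eq_integral borel_integrable_atLeastAtMost')
        (auto simp: elem_shift_def intro!: continuous_intros continuous_on_compose2[OF cont[OF e]])
    also have "\<dots> = integral {\<theta> e + c..\<theta> (e + 1) + c} (F e)"
      unfolding shift by (rule integral_shift_Icc_real)
    also have "{\<theta> e + c..\<theta> (e + 1) + c} = {- elem_phi \<theta> e..elem_phi \<theta> e}"
      by (auto simp: c_def elem_phi_def elem_len_def field_simps)
    finally show "(LBINT x:{\<theta> e..\<theta> (e + 1)}. F e (elem_shift \<theta> e x)) =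
        integral {- elem_phi \<theta> e..elem_phi \<theta> e} (F e)" .
  qed
  finally show ?thesis .
qed

section \<open>Existence and uniqueness of the differentiation matrix\<close>

lemma sum_basis0_interior:
  assumes "x \<in> {\<theta> e<..<\<theta> (e + 1)}" "e \<in> {1..n}"
  shows "(\<Sum>k=1..n. basis0 \<theta> K k x * A k) = arc.arc_fun (elem_phi \<theta> e) K (elem_shift \<theta> e x) * A e"
proof -
  have "(\<Sum>k=1..n. basis0 \<theta> K k x * A k) =
      (\<Sum>k=1..n. if k = e then arc.arc_fun (elem_phi \<theta> e) K (elem_shift \<theta> e x) * A e else 0)"
    using basis0_interior[OF assms] by (intro sum.cong refl) auto
  then show ?thesis using assms(2) by simp
qed

lemma diff_coef_eq_0:
  assumes "\<not> (K = J \<or> (odd J \<and> K + 2 = J) \<or> (even J \<and> K = J + 2))"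
  shows "diff_coef n \<theta> K J e j = 0"
proof (cases "e \<in> {1..n}")
  case True
  then show ?thesis using arc.dcoef_nonzero_iff[OF arc_elem[OF True], of K J] assms
    by (auto simp: diff_coef_def)
qed (auto simp: diff_coef_def)

lemma diff_coef_block_nonzero_iff:
  "\<not> mat_eq n (diff_coef n \<theta> K J) zero_matrix \<longleftrightarrow> K = J \<or> (odd J \<and> K + 2 = J) \<or> (even J \<and> K = J + 2)"
proof
  assume "K = J \<or> (odd J \<and> K + 2 = J) \<or> (even J \<and> K = J + 2)"
  then have "arc.dcoef (elem_phi \<theta> 1) K J \<noteq> 0"
    using arc.dcoef_nonzero_iff[OF arc_elem[of 1]] n_ge_2 by simp
  then have "diff_coef n \<theta> K J 1 1 \<noteq> 0"
    using n_ge_2 elem_sign_diag by (simp add: diff_coef_def)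
  then show "\<not> mat_eq n (diff_coef n \<theta> K J) zero_matrix"
    using mat_eqD[of n _ zero_matrix 1 1] n_ge_2 by (auto simp: zero_matrix_def)
qed (use diff_coef_eq_0 in \<open>auto simp: mat_eq_def zero_matrix_def\<close>)

lemma finite_diff_coef_column: "finite {K. \<not> mat_eq n (diff_coef n \<theta> K J) zero_matrix}"
  by (rule finite_subset[of _ "{..J+2}"]) (auto simp: diff_coef_block_nonzero_iff)

text \<open>The freedom to choose any finite \<open>S\<close> covering the column lets two matrices
  be expanded over a common index set.\<close>

lemma infsum_basis0:
  assumes "x \<in> {\<theta> e<..<\<theta> (e + 1)}" "e \<in> {1..n}" "j \<in> {1..n}" "finite S"
    and "{K. \<not> mat_eq n (D K J) zero_matrix} \<subseteq> S"
  shows "(\<Sum>\<^sub>\<infinity>K. \<Sum>k=1..n. basis0 \<theta> K k x * D K J k j) =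
     (\<Sum>K\<in>S. D K J e j * arc.arc_fun (elem_phi \<theta> e) K (elem_shift \<theta> e x))"
proof -
  have "D K J e j = 0" if "K \<notin> S" for K
    using that assms(5) mat_eqD[OF _ assms(2,3), of "D K J" zero_matrix] by (auto simp: zero_matrix_def)
  then show ?thesis
    unfolding sum_basis0_interior[OF assms(1,2)]
    by (subst infsum_eq_sum[OF \<open>finite S\<close>]) (auto simp: mult.commute)
qed

lemma is_diff_matrix_diff_coef: "is_diff_matrix n \<theta> (diff_coef n \<theta>)"
  unfolding is_diff_matrix_def
proof (intro conjI allI ballI impI)
  fix J j e x assume j: "j \<in> {1..n}" and e: "e \<in> {1..n}" and x: "x \<in> {\<theta> e<..<\<theta> (e + 1)}"
  have "(\<Sum>\<^sub>\<infinity>K. \<Sum>k=1..n. basis0 \<theta> K k x * diff_coef n \<theta> K J k j) = local_deriv J e j (elem_shift \<theta> e x)"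
    unfolding local_deriv_def using e j
    by (subst infsum_basis0[OF x e j, of "{..J+2}"]) (auto simp: diff_coef_block_nonzero_iff diff_coef_def)
  then show "(basism1 n \<theta> J j has_real_derivative
      (\<Sum>\<^sub>\<infinity>K. \<Sum>k=1..n. basis0 \<theta> K k x * diff_coef n \<theta> K J k j)) (at x)"
    using basism1_has_derivative[OF x e j, of J] by simp
qed (use finite_diff_coef_column in \<open>auto simp: diff_coef_def\<close>)

text \<open>On element e, column j of block J lists the coefficients of one derivative in the local
  basis, and these are determined by independence.\<close>

lemma is_diff_matrix_unique:
  assumes D: "is_diff_matrix n \<theta> D"
  shows "D = diff_coef n \<theta>"
proof (intro ext)
  fix K J e j
  show "D K J e j = diff_coef n \<theta> K J e j"
  proof (cases "e \<in> {1..n} \<and> j \<in> {1..n}")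
    case False
    then show ?thesis using D by (auto simp: is_diff_matrix_def diff_coef_def)
  next
    case True
    then have e: "e \<in> {1..n}" and j: "j \<in> {1..n}" by auto
    interpret arc "elem_phi \<theta> e" by (rule arc_elem[OF e])
    \<comment> \<open>The position \<open>K\<close> is included so that independence can be applied
      to it even if both blocks vanish there.\<close>
    define S where "S = {K} \<union> {K. \<not> mat_eq n (D K J) zero_matrix} \<union> {K. \<not> mat_eq n (diff_coef n \<theta> K J) zero_matrix}"
    have S: "finite S"
      using D finite_diff_coef_column by (auto simp: S_def is_diff_matrix_def)
    have "(\<Sum>K\<in>S. (D K J e j - diff_coef n \<theta> K J e j) * arc_fun K y) = 0"
      if y: "y \<in> {- elem_phi \<theta> e<..<elem_phi \<theta> e}" for y
    proof -
      define x where "x = y + (\<theta> e + \<theta> (e + 1)) / 2"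
      have xy: "elem_shift \<theta> e x = y" by (simp add: x_def elem_shift_def)
      then have x: "x \<in> {\<theta> e<..<\<theta> (e + 1)}" using y elem_shift_mem by simp
      have "(\<Sum>\<^sub>\<infinity>K. \<Sum>k=1..n. basis0 \<theta> K k x * D K J k j) =
          (\<Sum>\<^sub>\<infinity>K. \<Sum>k=1..n. basis0 \<theta> K k x * diff_coef n \<theta> K J k j)"
        using D is_diff_matrix_diff_coef x e j unfolding is_diff_matrix_def
        by (intro DERIV_unique[of "basism1 n \<theta> J j" _ x]) blast+
      moreover have "{K. \<not> mat_eq n (D K J) zero_matrix} \<subseteq> S" "{K. \<not> mat_eq n (diff_coef n \<theta> K J) zero_matrix} \<subseteq> S"
        by (auto simp: S_def)
      ultimately show ?thesis
        by (simp only: infsum_basis0[OF x e j S] xy left_diff_distrib sum_subtractf diff_self)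
    qed
    then have "D K J e j - diff_coef n \<theta> K J e j = 0"
      by (rule arc_fun_independent[OF S]) (auto simp: S_def)
    then show ?thesis by simp
  qed
qed

lemma diff_matrix_eq: "diff_matrix n \<theta> = diff_coef n \<theta>"
  unfolding diff_matrix_def using is_diff_matrix_diff_coef is_diff_matrix_unique by blast

section \<open>Mass matrix and weak Laplacian\<close>

lemma mass_matrix_entry:
  assumes i: "i \<in> {1..n}" and j: "j \<in> {1..n}"
  shows "mass_matrix \<theta> I J i j = (if I = J \<and> i = j then arc.arc_sqnorm (elem_phi \<theta> i) I else 0)"
proof -
  define F where "F e y = (if i = e \<and> j = e then 1 else 0) * (arc.arc_fun (elem_phi \<theta> e) I y * arc.arc_fun (elem_phi \<theta> e) J y)" for e y
  have "mass_matrix \<theta> I J i j = (\<Sum>e=1..n. integral {- elem_phi \<theta> e..elem_phi \<theta> e} (F e))"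
    unfolding mass_matrix_def
  proof (rule L2_inner_split)
    show "basis0 \<theta> I i x * basis0 \<theta> J j x = F e (elem_shift \<theta> e x)"
      if "e \<in> {1..n}" "x \<in> {\<theta> e<..<\<theta> (e + 1)}" for e x
      using basis0_interior[OF that(2,1) i] basis0_interior[OF that(2,1) j] by (simp add: F_def)
    show "continuous_on UNIV (F e)" if "e \<in> {1..n}" for e
      unfolding F_def[abs_def]
      by (intro continuous_intros arc.continuous_on_arc_fun[OF arc_elem[OF that]])
  qed
  also have "\<dots> = (\<Sum>e=1..n. if e = i then (if I = J \<and> i = j then arc.arc_sqnorm (elem_phi \<theta> i) I else 0) else 0)"
  proof (intro sum.cong refl)
    fix e assume e: "e \<in> {1..n}"
    interpret arc "elem_phi \<theta> e" by (rule arc_elem[OF e])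
    show "integral {- elem_phi \<theta> e..elem_phi \<theta> e} (F e) =
        (if e = i then (if I = J \<and> i = j then arc.arc_sqnorm (elem_phi \<theta> i) I else 0) else 0)"
      unfolding F_def[abs_def] integral_mult_right
      using integral_arc_fun_arc_fun[of I J] arc_sqnorm_def[of I] by auto
  qed
  finally show ?thesis using i by simp
qed

text \<open>Since the local bases are orthogonal, only the diagonal terms of the product of the two
  expansions survive integration.\<close>

definition stiffness :: "nat \<Rightarrow> nat \<Rightarrow> nat \<Rightarrow> real" where
  "stiffness e I J =
     (\<Sum>K\<le>J+2. arc.dcoef (elem_phi \<theta> e) K I * arc.dcoef (elem_phi \<theta> e) K J * arc.arc_sqnorm (elem_phi \<theta> e) K)"

lemma continuous_on_local_deriv:
  assumes "e \<in> {1..n}"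
  shows "continuous_on S (local_deriv J e j)"
  unfolding local_deriv_def[abs_def]
  by (intro continuous_intros arc.continuous_on_arc_fun[OF arc_elem[OF assms]])

lemma weak_laplacian_entry:
  assumes i: "i \<in> {1..n}" and j: "j \<in> {1..n}"
  shows "weak_laplacian n \<theta> I J i j =
     (\<Sum>e=1..n. elem_sign n I e i * elem_sign n J e j * stiffness e I J)"
proof -
  have "weak_laplacian n \<theta> I J i j =
      (\<Sum>e=1..n. integral {- elem_phi \<theta> e..elem_phi \<theta> e} (\<lambda>y. local_deriv I e i y * local_deriv J e j y))"
    unfolding weak_laplacian_def
    by (rule L2_inner_split)
      (simp_all only: pw_deriv_interior i j continuous_on_mult continuous_on_local_deriv)
  also have "\<dots> = (\<Sum>e=1..n. elem_sign n I e i * elem_sign n J e j * stiffness e I J)"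
  proof (intro sum.cong refl)
    fix e assume e: "e \<in> {1..n}"
    interpret arc "elem_phi \<theta> e" by (rule arc_elem[OF e])
    let ?s = "\<lambda>K. elem_sign n I e i * dcoef K I * (elem_sign n J e j * dcoef K J) * arc_sqnorm K"
    have "integral {- elem_phi \<theta> e..elem_phi \<theta> e} (\<lambda>y. local_deriv I e i y * local_deriv J e j y) =
        (\<Sum>K\<in>{..I + 2} \<inter> {..J + 2}. ?s K)"
      unfolding local_deriv_def by (rule integral_sum_arc_fun_sum) auto
    also have "\<dots> = (\<Sum>K\<le>J + 2. ?s K)"
    proof (rule sum.mono_neutral_left)
      show "\<forall>K\<in>{..J + 2} - {..I + 2} \<inter> {..J + 2}. ?s K = 0"
        using dcoef_nonzero_iff[of _ I] by auto
    qed auto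
    also have "\<dots> = elem_sign n I e i * elem_sign n J e j * stiffness e I J"
      unfolding stiffness_def sum_distrib_left by (intro sum.cong refl) simp
    finally show "integral {- elem_phi \<theta> e..elem_phi \<theta> e} (\<lambda>y. local_deriv I e i y * local_deriv J e j y) =
        elem_sign n I e i * elem_sign n J e j * stiffness e I J" .
  qed
  finally show ?thesis .
qed

lemma diff_transpose_mass:
  assumes i: "i \<in> {1..n}" and k: "k \<in> {1..n}"
  shows "block_mult n (block_transpose (diff_coef n \<theta>)) (mass_matrix \<theta>) I K i k =
     diff_coef n \<theta> K I k i * arc.arc_sqnorm (elem_phi \<theta> k) K"
proof -
  have "mat_mult n (block_transpose (diff_coef n \<theta>) I L) (mass_matrix \<theta> L K) i k =
      (if L = K then diff_coef n \<theta> K I k i * arc.arc_sqnorm (elem_phi \<theta> k) K else 0)" for L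
  proof -
    have "mat_mult n (block_transpose (diff_coef n \<theta>) I L) (mass_matrix \<theta> L K) i k =
        (\<Sum>l=1..n. if l = k then (if L = K then diff_coef n \<theta> K I k i * arc.arc_sqnorm (elem_phi \<theta> k) K else 0) else 0)"
      unfolding mat_mult_def block_transpose_def
      by (intro sum.cong refl) (simp add: mass_matrix_entry[OF _ k])
    then show ?thesis using k by simp
  qed
  then show ?thesis
    unfolding block_mult_def by (subst infsum_eq_sum[of "{K}"]) auto
qed

text \<open>Because the mass matrix is diagonal, the triple product is a sum over row blocks and
  elements of two coefficients times a squared norm; exchanging the sums gives the Laplacian element
  by element.\<close>

lemma weak_laplacian_factorization:
  "mat_eq n (weak_laplacian n \<theta> I J)
     (block_mult n (block_mult n (block_transpose (diff_coef n \<theta>)) (mass_matrix \<theta>)) (diff_coef n \<theta>) I J)"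
  unfolding mat_eq_def
proof (intro ballI)
  fix i j assume i: "i \<in> {1..n}" and j: "j \<in> {1..n}"
  let ?A = "block_mult n (block_transpose (diff_coef n \<theta>)) (mass_matrix \<theta>)"
  have eq: "mat_mult n (?A I K) (diff_coef n \<theta> K J) i j =
      (\<Sum>k=1..n. diff_coef n \<theta> K I k i * arc.arc_sqnorm (elem_phi \<theta> k) K * diff_coef n \<theta> K J k j)" for K
    unfolding mat_mult_def by (intro sum.cong refl) (simp add: diff_transpose_mass[OF i])
  have "block_mult n ?A (diff_coef n \<theta>) I J i j =
      (\<Sum>K\<le>J + 2. \<Sum>k=1..n. diff_coef n \<theta> K I k i * arc.arc_sqnorm (elem_phi \<theta> k) K * diff_coef n \<theta> K J k j)"
    unfolding block_mult_def[of n ?A] eq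
    by (rule infsum_eq_sum) (auto simp: diff_coef_eq_0)
  also have "\<dots> = (\<Sum>k=1..n. \<Sum>K\<le>J + 2. diff_coef n \<theta> K I k i * arc.arc_sqnorm (elem_phi \<theta> k) K * diff_coef n \<theta> K J k j)"
    by (rule sum.swap)
  also have "\<dots> = (\<Sum>k=1..n. elem_sign n I k i * elem_sign n J k j * stiffness k I J)"
    unfolding stiffness_def sum_distrib_left using i j
    by (intro sum.cong refl) (simp add: diff_coef_def)
  finally show "weak_laplacian n \<theta> I J i j = block_mult n ?A (diff_coef n \<theta>) I J i j"
    by (simp add: weak_laplacian_entry[OF i j])
qed

section \<open>Cyclic banded structure\<close>

lemma elem_sign_0_nonzero: "elem_sign n 0 e j \<noteq> 0 \<longleftrightarrow> e = j \<or> e = cyc_pred n j"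
  by (simp add: elem_sign_def)

lemma elem_sign_pos_nonzero: "J \<ge> 1 \<Longrightarrow> elem_sign n J e j \<noteq> 0 \<longleftrightarrow> e = j"
  by (simp add: elem_sign_def)

text \<open>For sub-bandwidths (1,0) the wrap-around exception admits only the position (1,n), for
  (0,1) only (n,1). Each band thus says that the indices agree or that a fixed one of them is the
  cyclic predecessor of the other.\<close>

lemma CB3_I:
  assumes band: "\<And>I J. \<not> (- int 2 \<le> int J - int I \<and> int J - int I \<le> int 2) \<Longrightarrow> mat_eq n (A I J) zero_matrix"
    and diag: "\<And>I J i j. I \<ge> 1 \<Longrightarrow> J \<ge> 1 \<Longrightarrow> i \<in> {1..n} \<Longrightarrow> j \<in> {1..n} \<Longrightarrow> i \<noteq> j \<Longrightarrow> A I J i j = 0"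
    and row: "\<And>J i j. J \<ge> 1 \<Longrightarrow> i \<in> {1..n} \<Longrightarrow> j \<in> {1..n} \<Longrightarrow> i \<noteq> j \<Longrightarrow> j \<noteq> cyc_pred n i \<Longrightarrow> A 0 J i j = 0"
    and col: "\<And>I i j. I \<ge> 1 \<Longrightarrow> i \<in> {1..n} \<Longrightarrow> j \<in> {1..n} \<Longrightarrow> i \<noteq> j \<Longrightarrow> i \<noteq> cyc_pred n j \<Longrightarrow> A I 0 i j = 0"
    and corner: "\<And>i j. i \<in> {1..n} \<Longrightarrow> j \<in> {1..n} \<Longrightarrow> i \<noteq> j \<Longrightarrow> i \<noteq> cyc_pred n j \<Longrightarrow> j \<noteq> cyc_pred n i \<Longrightarrow> A 0 0 i j = 0"
  shows "CB3 n 2 2 1 0 A"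
  unfolding CB3_def
proof (intro conjI allI impI)
  show "cyclic_banded n (1 + 0) (1 + 0) (A 0 0)"
    unfolding cyclic_banded_def
    by (intro ballI impI corner) (auto simp: cyc_pred_def split: if_splits)
  show "cyclic_banded n 1 0 (A 0 J)" if "J \<ge> 1" for J
    unfolding cyclic_banded_def using that
    by (intro ballI impI row) (auto simp: cyc_pred_def split: if_splits)
  show "cyclic_banded n 0 1 (A I 0)" if "I \<ge> 1" for I
    unfolding cyclic_banded_def using that
    by (intro ballI impI col) (auto simp: cyc_pred_def split: if_splits)
qed (use band diag in auto)

lemma CB3_diff_coef: "CB3 n 2 2 1 0 (diff_coef n \<theta>)"
proof (rule CB3_I)
  show "mat_eq n (diff_coef n \<theta> I J) zero_matrix"
    if "\<not> (- int 2 \<le> int J - int I \<and> int J - int I \<le> int 2)" for I J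
    using diff_coef_block_nonzero_iff[of I J] that by auto
  show "diff_coef n \<theta> I J i j = 0" if "J \<ge> 1" "i \<noteq> j" for I J i j
    using elem_sign_pos_nonzero[OF that(1), of i j] that by (auto simp: diff_coef_def)
  then show "diff_coef n \<theta> 0 J i j = 0" if "J \<ge> 1" "i \<noteq> j" for J i j
    using that by blast
  show "diff_coef n \<theta> I 0 i j = 0" if "i \<noteq> j" "i \<noteq> cyc_pred n j" for i j I
    using elem_sign_0_nonzero[of i j] that by (auto simp: diff_coef_def)
  then show "diff_coef n \<theta> 0 0 i j = 0" if "i \<noteq> j" "i \<noteq> cyc_pred n j" for i j
    using that by blast
qed

text \<open>Multiplying bandwidths would suggest 4. But a column meets rows of its own parity only,
  namely J with J - 2 (odd) or J + 2 (even), so two columns share a row only at distance 0 or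
  2.\<close>

lemma CB3_weak_laplacian: "CB3 n 2 2 1 0 (weak_laplacian n \<theta>)"
proof (rule CB3_I)
  show "mat_eq n (weak_laplacian n \<theta> I J) zero_matrix"
    if IJ: "\<not> (- int 2 \<le> int J - int I \<and> int J - int I \<le> int 2)" for I J
    unfolding mat_eq_def
  proof (intro ballI)
    fix i j assume i: "i \<in> {1..n}" and j: "j \<in> {1..n}"
    have "stiffness e I J = 0" if "e \<in> {1..n}" for e
    proof -
      interpret arc "elem_phi \<theta> e" by (rule arc_elem[OF that])
      have "- int 2 \<le> int J - int I \<and> int J - int I \<le> int 2"
        if "K = I \<or> odd I \<and> K + 2 = I \<or> even I \<and> K = I + 2"
          "K = J \<or> odd J \<and> K + 2 = J \<or> even J \<and> K = J + 2" for K
        using that by presburger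
      then have "dcoef K I = 0 \<or> dcoef K J = 0" for K
        using dcoef_nonzero_iff[of K I] dcoef_nonzero_iff[of K J] IJ by blast
      then show ?thesis unfolding stiffness_def by (intro sum.neutral) auto
    qed
    then show "weak_laplacian n \<theta> I J i j = zero_matrix i j"
      by (simp add: weak_laplacian_entry[OF i j] zero_matrix_def)
  qed
  have zero: "weak_laplacian n \<theta> I J i j = 0"
    if "i \<in> {1..n}" "j \<in> {1..n}"
      and "\<And>e. e \<in> {1..n} \<Longrightarrow> elem_sign n I e i \<noteq> 0 \<Longrightarrow> elem_sign n J e j \<noteq> 0 \<Longrightarrow> False" for I J i j
    unfolding weak_laplacian_entry[OF that(1,2)]
  proof (intro sum.neutral ballI)
    show "elem_sign n I e i * elem_sign n J e j * stiffness e I J = 0" if "e \<in> {1..n}" for e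
      using \<open>\<And>e. e \<in> {1..n} \<Longrightarrow> elem_sign n I e i \<noteq> 0 \<Longrightarrow> elem_sign n J e j \<noteq> 0 \<Longrightarrow> False\<close>[OF that] by auto
  qed
  show "weak_laplacian n \<theta> I J i j = 0"
    if "I \<ge> 1" "J \<ge> 1" "i \<in> {1..n}" "j \<in> {1..n}" "i \<noteq> j" for I J i j
    using that by (intro zero) (auto simp: elem_sign_pos_nonzero)
  show "weak_laplacian n \<theta> 0 J i j = 0"
    if "J \<ge> 1" "i \<in> {1..n}" "j \<in> {1..n}" "i \<noteq> j" "j \<noteq> cyc_pred n i" for J i j
    using that by (intro zero) (auto simp: elem_sign_pos_nonzero elem_sign_0_nonzero)
  show "weak_laplacian n \<theta> I 0 i j = 0"
    if "I \<ge> 1" "i \<in> {1..n}" "j \<in> {1..n}" "i \<noteq> j" "i \<noteq> cyc_pred n j" for I i j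
    using that by (intro zero) (auto simp: elem_sign_pos_nonzero elem_sign_0_nonzero)
  show "weak_laplacian n \<theta> 0 0 i j = 0"
    if "i \<in> {1..n}" "j \<in> {1..n}" "i \<noteq> j" "i \<noteq> cyc_pred n j" "j \<noteq> cyc_pred n i" for i j
  proof (rule zero[OF that(1,2)])
    fix e assume "elem_sign n 0 e i \<noteq> 0" "elem_sign n 0 e j \<noteq> 0"
    \<comment> \<open>Distinct non-neighbouring hats could meet only on a common preceding element,
      and \<open>cyc_pred\<close> is injective on {1..n}.\<close>
    then have "cyc_pred n i = cyc_pred n j" using that by (auto simp: elem_sign_0_nonzero)
    then show False using that by (auto simp: cyc_pred_def split: if_splits)
  qed
qed

section \<open>Identification of the individual blocks\<close>

lemma diff_coef_blocks: "\<not> mat_eq n (diff_coef n \<theta> I J) zero_matrix \<longleftrightarrow> (I, J) \<in> diff_blocks"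
proof -
  have "(I, J) \<in> diff_blocks \<longleftrightarrow> I = J \<or> (odd J \<and> I + 2 = J) \<or> (even J \<and> I = J + 2)"
  proof
    assume "(I, J) \<in> diff_blocks"
    then show "I = J \<or> (odd J \<and> I + 2 = J) \<or> (even J \<and> I = J + 2)"
      unfolding diff_blocks_def row_pos_def col_pos_def by (auto; presburger)
  next
    assume *: "I = J \<or> (odd J \<and> I + 2 = J) \<or> (even J \<and> I = J + 2)"
    show "(I, J) \<in> diff_blocks"
    proof (cases "J = 0")
      case True
      then show ?thesis using * by (auto simp: diff_blocks_def row_pos_def)
    next
      case False
      show ?thesis
      proof (cases "odd J")
        case True
        then obtain k where k: "J = 2 * k + 1" by (rule oddE)
        then have "J = col_pos (k + 1) 2" by (simp add: col_pos_def)
        moreover have "I = row_pos (k + 1) 1 \<or> (k + 1 \<ge> 2 \<and> I = row_pos (k + 1 - 1) 1)"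
          using * k by (auto simp: row_pos_def)
        ultimately show ?thesis unfolding diff_blocks_def by (auto intro: exI[of _ "k + 1"])
      next
        case even: False
        then obtain k where k: "J = 2 * k" by (auto elim: evenE)
        then have "J = col_pos (k + 1) 1" "k + 1 \<ge> 2" using False by (auto simp: col_pos_def)
        moreover have "I = row_pos (k + 1 - 1) 2 \<or> I = row_pos (k + 1) 2"
          using * k by (auto simp: row_pos_def)
        ultimately show ?thesis unfolding diff_blocks_def by (auto intro: exI[of _ "k + 1"])
      qed
    qed
  qed
  then show ?thesis by (simp add: diff_coef_block_nonzero_iff)
qed

lemma diff_coef_arc_blocks:
  "m \<ge> 1 \<Longrightarrow> mat_eq n (diff_coef n \<theta> (row_pos m 1) (col_pos m 2)) (D_p \<theta> m (m + 1))"
  "m \<ge> 2 \<Longrightarrow> mat_eq n (diff_coef n \<theta> (row_pos (m - 1) 1) (col_pos m 2)) (D_p \<theta> (m - 1) (m + 1))"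
  "m \<ge> 2 \<Longrightarrow> mat_eq n (diff_coef n \<theta> (row_pos (m - 1) 2) (col_pos m 1)) (D_q \<theta> m m)"
  "m \<ge> 2 \<Longrightarrow> mat_eq n (diff_coef n \<theta> (row_pos m 2) (col_pos m 1)) (D_q \<theta> (m + 1) m)"
proof -
  have dc: "diff_coef n \<theta> K J i j = (if i = j then arc.dcoef (elem_phi \<theta> i) K J else 0)"
    if "J \<ge> 1" "i \<in> {1..n}" "j \<in> {1..n}" for K J i j
    using that by (simp add: diff_coef_def elem_sign_def)
  have dco: "arc.dcoef (elem_phi \<theta> i) K J =
     (if J = 0 then arc.hat_coef (elem_phi \<theta> i) K
      else if odd J then
        (if K = J then arc_d_p (elem_h \<theta> i) ((J + 1) div 2) ((J + 1) div 2 + 1)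
         else if K + 2 = J then arc_d_p (elem_h \<theta> i) ((J + 1) div 2 - 1) ((J + 1) div 2 + 1) else 0)
      else
        (if K = J then arc_d_q (elem_h \<theta> i) (J div 2 + 1) (J div 2 + 1)
         else if K = J + 2 then arc_d_q (elem_h \<theta> i) (J div 2 + 2) (J div 2 + 1) else 0))"
    if "i \<in> {1..n}" for i K J
    unfolding arc.dcoef_def[OF arc_elem[OF that]] elem_h_def ..
  show "mat_eq n (diff_coef n \<theta> (row_pos m 1) (col_pos m 2)) (D_p \<theta> m (m + 1))" if "m \<ge> 1"
  proof -
    \<comment> \<open>Writing m as a sum removes the truncated subtractions in the block
      positions.\<close>
    obtain k where "m = k + 1" using \<open>m \<ge> 1\<close> by (metis add.commute le_Suc_ex)
    then show ?thesis
      by (auto simp: mat_eq_def dc dco D_p_def diag_matrix_def row_pos_def col_pos_def)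
  qed
  show "mat_eq n (diff_coef n \<theta> (row_pos (m - 1) 1) (col_pos m 2)) (D_p \<theta> (m - 1) (m + 1))"
    "mat_eq n (diff_coef n \<theta> (row_pos (m - 1) 2) (col_pos m 1)) (D_q \<theta> m m)"
    "mat_eq n (diff_coef n \<theta> (row_pos m 2) (col_pos m 1)) (D_q \<theta> (m + 1) m)" if "m \<ge> 2"
  proof -
    obtain k where "m = k + 2" using \<open>m \<ge> 2\<close> by (metis add.commute le_Suc_ex)
    then show "mat_eq n (diff_coef n \<theta> (row_pos (m - 1) 1) (col_pos m 2)) (D_p \<theta> (m - 1) (m + 1))"
      "mat_eq n (diff_coef n \<theta> (row_pos (m - 1) 2) (col_pos m 1)) (D_q \<theta> m m)"
      "mat_eq n (diff_coef n \<theta> (row_pos m 2) (col_pos m 1)) (D_q \<theta> (m + 1) m)"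
      by (auto simp: mat_eq_def dc dco D_p_def D_q_def diag_matrix_def row_pos_def col_pos_def)
  qed
qed

lemma norm_sq_p_eq:
  assumes "i \<in> {1..n}"
  shows "norm_sq_p \<theta> m i = arc.arc_sqnorm (elem_phi \<theta> i) (2 * m)"
proof -
  interpret arc "elem_phi \<theta> i" by (rule arc_elem[OF assms])
  have "norm_sq_p \<theta> m i = (LBINT x:{- elem_phi \<theta> i..elem_phi \<theta> i}. arc_fun (2 * m) x * arc_fun (2 * m) x)"
    unfolding norm_sq_p_def elem_h_def arc_p_conv_arc_fun by (simp add: power2_eq_square)
  also have "\<dots> = arc_sqnorm (2 * m)"
    unfolding arc_sqnorm_def
    by (intro set_borel_integral_eq_integral borel_integrable_atLeastAtMost' continuous_intros)
  finally show ?thesis .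
qed

text \<open>Only element i contributes, and there the hat has slope \<open>elem_sign n 0 i j\<close>
  times cos/(2 sin \<phi>).\<close>

lemma PtH'_entry:
  assumes i: "i \<in> {1..n}" and j: "j \<in> {1..n}"
  shows "PtH' n \<theta> m 2 i j =
     elem_sign n 0 i j * (arc.hat_coef (elem_phi \<theta> i) (2 * m) * arc.arc_sqnorm (elem_phi \<theta> i) (2 * m))"
proof -
  define F where "F e y = (if e = i then 1 else 0) * (arc.arc_fun (elem_phi \<theta> e) (2 * m) y * local_deriv 0 e j y)" for e y
  have hat: "hat n \<theta> j = basism1 n \<theta> 0 j"
    by (rule ext) (simp add: basism1_def)
  have "PtH' n \<theta> m 2 i j = (\<Sum>e=1..n. integral {- elem_phi \<theta> e..elem_phi \<theta> e} (F e))"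
    unfolding PtH'_def
  proof (rule L2_inner_split)
    show "pw_arc 0 \<theta> m 2 i x * pw_deriv n \<theta> (hat n \<theta> j) x = F e (elem_shift \<theta> e x)"
      if "e \<in> {1..n}" "x \<in> {\<theta> e<..<\<theta> (e + 1)}" for e x
      unfolding hat pw_deriv_interior[OF that(2,1) j] pw_arc_interior[OF that(2,1) i]
      using arc.arc_p_conv_arc_fun[OF arc_elem[OF that(1)], of m]
      by (simp add: F_def elem_h_def)
    show "continuous_on UNIV (F e)" if "e \<in> {1..n}" for e
      unfolding F_def[abs_def]
      by (intro continuous_intros continuous_on_local_deriv that arc.continuous_on_arc_fun[OF arc_elem[OF that]])
  qed
  also have "\<dots> = (\<Sum>e=1..n. if e = i then integral {- elem_phi \<theta> i..elem_phi \<theta> i}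
      (\<lambda>y. arc.arc_fun (elem_phi \<theta> i) (2 * m) y * local_deriv 0 i j y) else 0)"
    unfolding F_def[abs_def] integral_mult_right by (intro sum.cong refl) auto
  also have "\<dots> = integral {- elem_phi \<theta> i..elem_phi \<theta> i} (\<lambda>y. arc.arc_fun (elem_phi \<theta> i) (2 * m) y * local_deriv 0 i j y)"
    using i by simp
  also have "\<dots> = elem_sign n 0 i j * (arc.hat_coef (elem_phi \<theta> i) (2 * m) * arc.arc_sqnorm (elem_phi \<theta> i) (2 * m))"
  proof -
    interpret arc "elem_phi \<theta> i" by (rule arc_elem[OF i])
    have "local_deriv 0 i j y = elem_sign n 0 i j * (\<Sum>K\<le>2. hat_coef K * arc_fun K y)" for y
      unfolding local_deriv_def sum_distrib_left by (simp add: dcoef_def mult.assoc numeral_2_eq_2)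
    then have "arc_fun (2 * m) y * local_deriv 0 i j y = elem_sign n 0 i j * (arc_fun (2 * m) y * (cos y / (2 * sin (elem_phi \<theta> i))))" for y
      by (simp only: hat_coef_expansion mult.left_commute)
    then show ?thesis
      by (simp only: integral_mult_right integral_arc_fun_cos)
  qed
  finally show ?thesis .
qed

text \<open>The inverse norm cancels the squared norm in the inner product and leaves the bare
  coefficient of the hat slope.\<close>

lemma diff_coef_hat_block:
  assumes "m \<le> 1"
  shows "mat_eq n (diff_coef n \<theta> (row_pos m 2) 0) (mat_mult n (inv_norm_matrix \<theta> m) (PtH' n \<theta> m 2))"
  unfolding mat_eq_def
proof (intro ballI)
  fix i j assume i: "i \<in> {1..n}" and j: "j \<in> {1..n}"
  interpret arc "elem_phi \<theta> i" by (rule arc_elem[OF i])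
  have "mat_mult n (inv_norm_matrix \<theta> m) (PtH' n \<theta> m 2) i j =
      (\<Sum>k=1..n. if k = i then inverse (norm_sq_p \<theta> m i) * PtH' n \<theta> m 2 i j else 0)"
    unfolding mat_mult_def by (intro sum.cong refl) (auto simp: inv_norm_matrix_def diag_matrix_def)
  also have "\<dots> = inverse (norm_sq_p \<theta> m i) * PtH' n \<theta> m 2 i j" using i by simp
  also have "\<dots> = elem_sign n 0 i j * hat_coef (2 * m)"
    using arc_sqnorm_pos[of "2 * m"] by (simp add: norm_sq_p_eq[OF i] PtH'_entry[OF i j] field_simps)
  also have "\<dots> = diff_coef n \<theta> (row_pos m 2) 0 i j"
    using i j by (simp add: diff_coef_def dcoef_def row_pos_def)
  finally show "diff_coef n \<theta> (row_pos m 2) 0 i j = mat_mult n (inv_norm_matrix \<theta> m) (PtH' n \<theta> m 2) i j" ..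
qed

text \<open>By sin 2\<phi> = 2 sin \<phi> cos \<phi> the cosine cancels unless \<phi> = \<pi>/2, and
  that case is the prescribed limit.\<close>

lemma h_csc_eq:
  assumes "i \<in> {1..n}"
  shows "h_csc \<theta> i = 1 / (2 * sin (elem_phi \<theta> i))"
proof (cases "elem_len \<theta> i = pi")
  case False
  interpret arc "elem_phi \<theta> i" by (rule arc_elem[OF assms])
  have len: "elem_len \<theta> i = 2 * elem_phi \<theta> i" by (simp add: elem_phi_def)
  have "cos (elem_phi \<theta> i) \<noteq> cos (pi / 2)"
    using cos_inj_pi[of "elem_phi \<theta> i" "pi / 2"] phi_pos phi_less_pi False len by auto
  then show ?thesis
    using False sin_phi_pos by (simp add: h_csc_def elem_h_def len sin_double)
qed (simp add: h_csc_def)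

lemma zeta_eq: "i \<in> {1..n} \<Longrightarrow> zeta \<theta> i = arc.arc_zeta (elem_phi \<theta> i)"
  by (simp add: zeta_def h_csc_eq arc.arc_zeta_def[OF arc_elem] elem_tau_def elem_h_def arc_tau_def)

text \<open>Passes from the cyclic predecessor of the column to the cyclic successor of the row, the
  form used for the two explicit matrices.\<close>

lemma elem_sign_0_eq:
  assumes "i \<in> {1..n}" "j \<in> {1..n}"
  shows "elem_sign n 0 i j = (if j = i then - 1 else if j = i + 1 \<or> (i = n \<and> j = 1) then 1 else 0)"
  using assms n_ge_2 by (auto simp: elem_sign_def cyc_pred_def)

lemma PtH'_0:
  assumes "i \<in> {1..n}" "j \<in> {1..n}"
  shows "PtH' n \<theta> 0 2 i j = (if j = i then - 1 else if j = i + 1 \<or> (i = n \<and> j = 1) then 1 else 0)"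
  using arc.hat_coef_0[OF arc_elem[OF assms(1)]]
  by (simp add: PtH'_entry[OF assms] elem_sign_0_eq[OF assms])

lemma PtH'_1:
  assumes "i \<in> {1..n}" "j \<in> {1..n}"
  shows "PtH' n \<theta> 1 2 i j =
    (if j = i then zeta \<theta> i else if j = i + 1 \<or> (i = n \<and> j = 1) then - zeta \<theta> i else 0)"
  using arc.hat_coef_2[OF arc_elem[OF assms(1)]]
  by (simp add: PtH'_entry[OF assms] elem_sign_0_eq[OF assms] zeta_eq[OF assms(1)])

end

theorem proposition11:
  fixes n :: nat and \<theta> :: "nat \<Rightarrow> real"
  assumes "n \<ge> 2"
    and "\<theta> 1 = - pi" and "\<theta> (n + 1) = pi"
    and "\<forall>i\<in>{1..n}. \<theta> i < \<theta> (i + 1)"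
  shows
    "(\<exists>!D. is_diff_matrix n \<theta> D) \<and>
     CB3 n 2 2 1 0 (diff_matrix n \<theta>) \<and>
     (\<forall>I J. \<not> mat_eq n (diff_matrix n \<theta> I J) zero_matrix \<longleftrightarrow> (I, J) \<in> diff_blocks) \<and>
     mat_eq n (diff_matrix n \<theta> (row_pos 0 2) 0) (mat_mult n (inv_norm_matrix \<theta> 0) (PtH' n \<theta> 0 2)) \<and>
     mat_eq n (diff_matrix n \<theta> (row_pos 1 2) 0) (mat_mult n (inv_norm_matrix \<theta> 1) (PtH' n \<theta> 1 2)) \<and>
     (\<forall>m\<ge>1. mat_eq n (diff_matrix n \<theta> (row_pos m 1) (col_pos m 2)) (D_p \<theta> m (m + 1))) \<and>
     (\<forall>m\<ge>2. mat_eq n (diff_matrix n \<theta> (row_pos (m - 1) 1) (col_pos m 2)) (D_p \<theta> (m - 1) (m + 1))) \<and>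
     (\<forall>m\<ge>2. mat_eq n (diff_matrix n \<theta> (row_pos (m - 1) 2) (col_pos m 1)) (D_q \<theta> m m)) \<and>
     (\<forall>m\<ge>2. mat_eq n (diff_matrix n \<theta> (row_pos m 2) (col_pos m 1)) (D_q \<theta> (m + 1) m)) \<and>
     (\<forall>i\<in>{1..n}. \<forall>j\<in>{1..n}.
        PtH' n \<theta> 0 2 i j =
          (if j = i then - 1 else if j = i + 1 \<or> (i = n \<and> j = 1) then 1 else 0)) \<and>
     (\<forall>i\<in>{1..n}. \<forall>j\<in>{1..n}.
        PtH' n \<theta> 1 2 i j =
          (if j = i then zeta \<theta> i else if j = i + 1 \<or> (i = n \<and> j = 1) then - zeta \<theta> i else 0)) \<and>
     CB3 n 2 2 1 0 (weak_laplacian n \<theta>) \<and>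
     (\<forall>I J. mat_eq n (weak_laplacian n \<theta> I J)
        (block_mult n (block_mult n (block_transpose (diff_matrix n \<theta>)) (mass_matrix \<theta>))
           (diff_matrix n \<theta>) I J))"
proof -
  interpret grid n \<theta> by unfold_locales (use assms in auto)
  show ?thesis
    unfolding diff_matrix_eq
    using is_diff_matrix_diff_coef is_diff_matrix_unique CB3_diff_coef diff_coef_blocks
      diff_coef_hat_block[of 0] diff_coef_hat_block[of 1] diff_coef_arc_blocks
      PtH'_0 PtH'_1 CB3_weak_laplacian weak_laplacian_factorization
    by (intro conjI allI ballI impI) (blast | simp only: le_refl zero_le_one)+
qed

end
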